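(* Let $n\ge1$ and let $D(z)\in\mathbb{C}[z]$ be a monic polynomial of degree $2n$ with distinct roots $z_1,\dots,z_{2n}$. Then $D(z)$ is Pellian if and only if, for a suitable choice of $U(z)$ (which is determined by $D$ only up to multiplication by a nonzero real constant), all the integrals $$\int_{z_1}^{z_j}\frac{U(z)}{\sqrt{D(z)}}\,dz,\qquad j=2,\dots,2n,$$ are integer multiples of $\pi i$.
   Context: $D(z)$ is called Pellian if the polynomial Pell equation $p(z)^2-q(z)^2D(z)=1$ has a solution in polynomials $p,q\in\mathbb{C}[z]$ with $q\neq0$. Let $K=\{z_1,\dots,z_{2n}\}$, $X=\mathbb{C}\setminus K$, and let $\mathcal{L}$ be the unique real line bundle on $X$ with monodromy $-1$ around each point of $K$. A $\mathbb{Z}_2$ harmonic function is a section $f$ of $\mathcal{L}$ with $\Delta f=0$ in every local trivialization (where it is an ordinary real function up to sign), and such that $|\nabla f|$ has finite $L^2$ norm on every bounded open subset of $X$ (including punctured neighborhoods of the points of $K$). A trivialization of $\mathcal{L}$ outside a large disk containing $K$ is fixed. There is a unique $\mathbb{Z}_2$ harmonic function $G$ on $X$ such that $G(z)-\ln|z|$ tends to a constant as $|z|\to+\infty$, and there is a unique entire function $U_D$ (in fact a polynomial of degree $n-1$) with $dG=\mathrm{Re}\bigl(\frac{U_D(z)\,dz}{\sqrt{D(z)}}\bigr)$, where a sign convention for $\sqrt D$ as a section of $\mathcal{L}\otimes\mathbb{C}$ is fixed. $U(z)$ denotes $U_D$ up to multiplication by a nonzero real constant. The integral from $z_1$ to $z_j$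 is taken along a fixed path from $z_1$ to $z_j$ with interior in $X$, with a continuous choice of $\sqrt D$ along it. *)

theory Defs
  imports "HOL-Complex_Analysis.Complex_Analysis"
    "HOL-Computational_Algebra.Computational_Algebra"
begin

definition pellian :: "complex poly \<Rightarrow> bool" where
  "pellian D \<longleftrightarrow> (\<exists>p q. q \<noteq> 0 \<and> p ^ 2 - q ^ 2 * D = 1)"

definition partial :: "complex \<Rightarrow> (complex \<Rightarrow> real) \<Rightarrow> complex \<Rightarrow> real" where
  "partial v u z = frechet_derivative u (at z) v"

text \<open>Meant for open \<open>T\<close>: the function is of class C2 on \<open>T\<close> and its Laplacian vanishes there.\<close>

definition harmonic_on :: "(complex \<Rightarrow> real) \<Rightarrow> complex set \<Rightarrow> bool" where
  "harmonic_on u T \<longleftrightarrow>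
     (\<forall>z\<in>T. u differentiable (at z)) \<and>
     (\<forall>v\<in>{1, \<i>}. \<forall>z\<in>T. partial v u differentiable (at z)) \<and>
     (\<forall>v\<in>{1, \<i>}. \<forall>w\<in>{1, \<i>}. continuous_on T (partial w (partial v u))) \<and>
     (\<forall>z\<in>T. partial 1 (partial 1 u) z + partial \<i> (partial \<i> u) z = 0)"

text \<open>
  Let \<open>D\<close> have only simple roots, let \<open>K\<close> be the set of its roots and \<open>X\<close> the complement of \<open>K\<close>.
  The real line bundle on \<open>X\<close> with monodromy -1 around each point of \<open>K\<close> is modelled
  as the bundle associated with the double cover of \<open>X\<close> formed by the pairs \<open>(z, w)\<close> with
  \<open>w\<^sup>2 = D(z) \<noteq> 0\<close>. Thus a section is a real function \<open>F z w\<close> on that cover which is odd in \<open>w\<close>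
  (its values off the cover play no role), a local trivialization over an open set \<open>T\<close> is a
  continuous branch \<open>s\<close> of the square root of \<open>D\<close> on \<open>T\<close>, and in this trivialization the section is
  the function \<open>\<lambda>z. F z (s z)\<close>. The square root of \<open>D\<close>, as a section of the complexified
  bundle, is the function \<open>(z, w) \<mapsto> w\<close>, given by \<open>s\<close> in this trivialization.
\<close>

definition sqrt_branch :: "complex poly \<Rightarrow> complex set \<Rightarrow> (complex \<Rightarrow> complex) \<Rightarrow> bool" where
  "sqrt_branch D T s \<longleftrightarrow>
     open T \<and> (\<forall>z\<in>T. poly D z \<noteq> 0) \<and> continuous_on T s \<and> (\<forall>z\<in>T. (s z) ^ 2 = poly D z)"

definition line_bundle_section :: "complex poly \<Rightarrow> (complex \<Rightarrow> complex \<Rightarrow> real) \<Rightarrow> bool" where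
  "line_bundle_section D F \<longleftrightarrow>
     (\<forall>z w. poly D z \<noteq> 0 \<longrightarrow> w ^ 2 = poly D z \<longrightarrow> F z (- w) = - F z w)"

text \<open>
  The squared length of the gradient of a section at \<open>z\<close>, computed in the trivialization given
  near \<open>z\<close> by the branch \<open>\<lambda>\<zeta>. csqrt (D z) * csqrt (D \<zeta> / D z)\<close>, which is continuous near \<open>z\<close> since
  the quotient is close to 1; the other branch changes only the sign of the gradient.
\<close>

definition grad_norm_sq :: "complex poly \<Rightarrow> (complex \<Rightarrow> complex \<Rightarrow> real) \<Rightarrow> complex \<Rightarrow> real" where
  "grad_norm_sq D F z =
     (let u = (\<lambda>\<zeta>. F \<zeta> (csqrt (poly D z) * csqrt (poly D \<zeta> / poly D z)))
      in (partial 1 u z) ^ 2 + (partial \<i> u z) ^ 2)"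

definition Z2_harmonic :: "complex poly \<Rightarrow> (complex \<Rightarrow> complex \<Rightarrow> real) \<Rightarrow> bool" where
  "Z2_harmonic D F \<longleftrightarrow>
     line_bundle_section D F \<and>
     (\<forall>T s. sqrt_branch D T s \<longrightarrow> harmonic_on (\<lambda>z. F z (s z)) T) \<and>
     (\<forall>B. open B \<longrightarrow> bounded B \<longrightarrow> B \<subseteq> {z. poly D z \<noteq> 0} \<longrightarrow>
        set_integrable lebesgue B (grad_norm_sq D F))"

text \<open>
  For monic \<open>D\<close> of degree \<open>2 * n\<close>, the branch near infinity with \<open>sqrt D(z) / z ^ n \<longrightarrow> 1\<close>. It fixes
  the trivialization outside a large disk.
\<close>

definition sqrt_at_infinity :: "complex poly \<Rightarrow> complex \<Rightarrow> complex" where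
  "sqrt_at_infinity D z =
     z ^ (degree D div 2) * csqrt (poly D z / z ^ degree D)"

definition is_G :: "complex poly \<Rightarrow> (complex \<Rightarrow> complex \<Rightarrow> real) \<Rightarrow> bool" where
  "is_G D G \<longleftrightarrow>
     Z2_harmonic D G \<and>
     (\<exists>c. ((\<lambda>z. G z (sqrt_at_infinity D z) - ln (cmod z)) \<longlongrightarrow> c) at_infinity)"

definition is_U_D :: "complex poly \<Rightarrow> (complex \<Rightarrow> complex) \<Rightarrow> bool" where
  "is_U_D D V \<longleftrightarrow>
     V holomorphic_on UNIV \<and>
     (\<exists>G. is_G D G \<and>
        (\<forall>T s. sqrt_branch D T s \<longrightarrow>
           (\<forall>z\<in>T. ((\<lambda>\<zeta>. G \<zeta> (s \<zeta>)) has_derivative (\<lambda>h. Re (V z * h / s z))) (at z))))"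

definition is_U :: "complex poly \<Rightarrow> (complex \<Rightarrow> complex) \<Rightarrow> bool" where
  "is_U D U \<longleftrightarrow> (\<exists>V. \<exists>c::real. is_U_D D V \<and> c \<noteq> 0 \<and> U = (\<lambda>z. of_real c * V z))"

text \<open>
  The square root is continued along the path, hence it is a function \<open>r\<close> of the parameter and not
  of the point (the path may cross itself). Off the finitely many bad parameters the integrand is
  that of \<open>has_contour_integral\<close>; it is in general unbounded at the end points, where
  \<open>r\<close> vanishes, and the gauge integral covers this improper case.
\<close>

definition sqrt_along :: "complex poly \<Rightarrow> (real \<Rightarrow> complex) \<Rightarrow> (real \<Rightarrow> complex) \<Rightarrow> bool" where
  "sqrt_along D \<gamma> r \<longleftrightarrow>
     continuous_on {0..1} r \<and> (\<forall>t\<in>{0..1}. (r t) ^ 2 = poly D (\<gamma> t))"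

definition has_integral_U_over_sqrt ::
  "(complex \<Rightarrow> complex) \<Rightarrow> (real \<Rightarrow> complex) \<Rightarrow> complex \<Rightarrow> (real \<Rightarrow> complex) \<Rightarrow> bool" where
  "has_integral_U_over_sqrt U r I \<gamma> \<longleftrightarrow>
     ((\<lambda>t. U (\<gamma> t) / r t * vector_derivative \<gamma> (at t within {0..1})) has_integral I) {0..1}"

end

theory Submission
  imports Defs
begin

text \<open>
  If \<open>p\<^sup>2 - q\<^sup>2 D = 1\<close>, then \<open>q\<close> divides \<open>p'\<close>, and with \<open>V = p' / q\<close> the logarithmic derivative of
  \<open>p + q sqrt D\<close> is \<open>V / sqrt D\<close>. Hence \<open>ln \<bar>p + q sqrt D\<bar>\<close>, divided by the degree of \<open>p\<close>, is \<open>G\<close>, and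
  since \<open>p + q sqrt D = \<plusminus>1\<close> at the roots of \<open>D\<close>, all integrals of \<open>V / sqrt D\<close> between
  roots lie in \<open>\<pi> \<i> \<int>\<close>.

  Conversely let \<open>\<Phi>\<close> be a primitive of \<open>U / sqrt D\<close> on a slit plane, \<open>e a\<close> its value at the root \<open>a\<close>,
  and \<open>e z\<^sub>1 = 0\<close>. Continuation across the slit of \<open>a\<close> turns \<open>\<Phi>\<close> into \<open>2 e a - \<Phi>\<close>. Therefore, if all
  \<open>N e a\<close> are in \<open>\<pi> \<i> \<int>\<close>, then \<open>cosh (N \<Phi>)\<close> and \<open>sinh (N \<Phi>) / sqrt D\<close> are entire; they are
  polynomials because \<open>Re \<Phi>\<close> grows like \<open>G\<close>, that is, logarithmically. The given paths may be
  tangled, so the integral from \<open>z\<^sub>1\<close> to \<open>a\<close> only agrees with \<open>e a\<close> up to an even integer combination of the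
  numbers \<open>e c\<close>. This linear system has an odd determinant, so integrality of the given integrals
  makes every \<open>e a\<close> a rational multiple of \<open>\<pi> \<i>\<close>, and a suitable \<open>N\<close> exists.
\<close>

section \<open>Branches of roots and logarithms\<close>

text \<open>In the variable y with z = a - (a - b) y^2 the form U dz / sqrt D is holomorphic and
  even at the root, so its primitive is odd in y up to the constant \<open>e a\<close>. Crossing the
  slit of \<open>a\<close> replaces y by -y, which is the origin of 2 e a - \<Phi>. Once N e a is a
  multiple of pi \<i>, cosh (N \<Phi>) is unchanged by this reflection, while sinh (N \<Phi>)
  changes sign together with sqrt D.

  A piecewise C1 path may meet a slit infinitely often, so crossings cannot be counted. Instead the
  running integral is compared with a set of admissible values at each point of the double cover,
  and membership is propagated by connectedness of the parameter interval. The resulting linear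
  system has the form identity plus twice an integer matrix. Its determinant is odd but can differ
  from 1 and -1, so the \<open>e a\<close> come out only as rational multiples of pi \<i>; this is
  the reason for the factor N.

  In the other direction the sign of q matters: of p + q sqrt D and p - q sqrt D one grows at
  infinity and the other, its inverse, tends to 0. Only the growing one has a logarithm with the
  asymptotics of G.\<close>

lemma eventually_csqrt_quotient:
  fixes r :: "'a::real_normed_vector \<Rightarrow> complex"
  assumes "continuous (at x within S) r" and "x \<in> S" and "r x \<noteq> 0"
  shows "\<forall>\<^sub>F y in at x within S. csqrt ((r y)\<^sup>2 / (r x)\<^sup>2) = r y / r x"
proof -
  have "((\<lambda>y. Re (r y / r x)) \<longlongrightarrow> Re (r x / r x)) (at x within S)"
    using assms(1,3) unfolding continuous_within by (intro tendsto_Re tendsto_divide tendsto_const)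
  then have "\<forall>\<^sub>F y in at x within S. 0 < Re (r y / r x)"
    using order_tendstoD(1)[of _ "Re (r x / r x)" _ 0] assms(3) by simp
  then show ?thesis
    by (rule eventually_mono) (simp add: csqrt_square flip: power_divide)
qed

text \<open>Near \<open>x\<close> the branch coincides with
  \<open>r x * csqrt (g y / (r x)\<^sup>2)\<close>, where \<open>csqrt\<close> is evaluated near 1,
  away from its cut; so continuity is enough. The domain is a general normed space because branches
  on plane sets and roots continued along a real parameter are both treated.\<close>

lemma has_derivative_sqrt_branch:
  fixes r :: "'a::real_normed_vector \<Rightarrow> complex"
  assumes "continuous (at x within S) r" and "x \<in> S" and "r x \<noteq> 0"
    and "\<And>y. y \<in> S \<Longrightarrow> (r y)\<^sup>2 = g y"
    and "(g has_derivative g') (at x within S)"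
  shows "(r has_derivative (\<lambda>h. g' h / (2 * r x))) (at x within S)"
proof -
  have gx: "g x = (r x)\<^sup>2" using assms(2,4) by simp
  have "((\<lambda>y. g y / (r x)\<^sup>2) has_derivative (\<lambda>h. g' h / (r x)\<^sup>2)) (at x within S)"
    using assms(5,3) by (auto intro!: derivative_eq_intros simp: field_simps)
  moreover have "(csqrt has_derivative (*) (1/2)) (at (g x / (r x)\<^sup>2))"
    using has_field_derivative_csqrt[of 1] assms(3) gx
    by (simp add: has_field_derivative_def)
  ultimately have "((\<lambda>y. csqrt (g y / (r x)\<^sup>2)) has_derivative (\<lambda>h. 1/2 * (g' h / (r x)\<^sup>2))) (at x within S)"
    using has_derivative_compose by blast
  then have "((\<lambda>y. r x * csqrt (g y / (r x)\<^sup>2)) has_derivative (\<lambda>h. r x * (1/2 * (g' h / (r x)\<^sup>2)))) (at x within S)"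
    by (rule has_derivative_mult_right)
  also have "(\<lambda>h. r x * (1/2 * (g' h / (r x)\<^sup>2))) = (\<lambda>h. g' h / (2 * r x))"
    using assms(3) by (auto simp: field_simps power2_eq_square)
  finally show ?thesis
  proof (rule has_derivative_transform_eventually)
    have "\<forall>\<^sub>F y in at x within S. y \<in> S" by (simp add: eventually_at_topological) blast
    with eventually_csqrt_quotient[OF assms(1-3)]
    show "\<forall>\<^sub>F y in at x within S. r x * csqrt (g y / (r x)\<^sup>2) = r y"
      by eventually_elim (use assms(3,4) in auto)
  qed (use assms(2,3) gx in auto)
qed

text \<open>Same device as for square roots: near \<open>x\<close> the imaginary part of
  \<open>L y - L x\<close> stays within the range on which \<open>Ln\<close> inverts
  \<open>exp\<close>.\<close>

lemma has_derivative_log_branch: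
  fixes L :: "'a::real_normed_vector \<Rightarrow> complex"
  assumes "continuous (at x within S) L" and "x \<in> S"
    and "\<And>y. y \<in> S \<Longrightarrow> g y = exp (L y)"
    and "(g has_derivative g') (at x within S)"
  shows "(L has_derivative (\<lambda>h. g' h / g x)) (at x within S)"
proof -
  have g0: "g x \<noteq> 0" using assms(2,3) by simp
  have "((\<lambda>y. g y / g x) has_derivative (\<lambda>h. g' h / g x)) (at x within S)"
    using assms(4) g0 by (auto intro!: derivative_eq_intros simp: field_simps)
  moreover have "(Ln has_derivative (*) 1) (at (g x / g x))"
    using has_field_derivative_Ln[of 1] g0 by (simp add: has_field_derivative_def)
  ultimately have "((\<lambda>y. Ln (g y / g x)) has_derivative (\<lambda>h. 1 * (g' h / g x))) (at x within S)"
    using has_derivative_compose by blast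
  then have "((\<lambda>y. L x + Ln (g y / g x)) has_derivative (\<lambda>h. 0 + 1 * (g' h / g x))) (at x within S)"
    by (intro has_derivative_add has_derivative_const)
  also have "(\<lambda>h. 0 + 1 * (g' h / g x)) = (\<lambda>h. g' h / g x)" by simp
  finally show ?thesis
  proof (rule has_derivative_transform_eventually)
    have in_S: "\<forall>\<^sub>F y in at x within S. y \<in> S" by (simp add: eventually_at_topological) blast
    have "((\<lambda>y. Im (L y - L x)) \<longlongrightarrow> Im (L x - L x)) (at x within S)"
      using assms(1) unfolding continuous_within by (intro tendsto_Im tendsto_diff tendsto_const)
    then have "\<forall>\<^sub>F y in at x within S. - pi < Im (L y - L x)" "\<forall>\<^sub>F y in at x within S. Im (L y - L x) < pi"
      by (auto intro: order_tendstoD)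
    with in_S show "\<forall>\<^sub>F y in at x within S. L x + Ln (g y / g x) = L y"
      by eventually_elim (use assms(2,3) in \<open>auto simp flip: exp_diff simp: Ln_exp\<close>)
  qed (use assms(2) g0 in auto)
qed

text \<open>Locally \<open>u\<close> is the real part of a primitive of \<open>f\<close>. Its second
  partials are the real parts of \<open>deriv f z * w * v\<close>, and 1 + \<i> * \<i> = 0 kills the
  Laplacian.\<close>

lemma harmonic_on_if_Re_derivative:
  assumes "open T" and "f holomorphic_on T"
    and u: "\<And>z. z \<in> T \<Longrightarrow> (u has_derivative (\<lambda>h. Re (f z * h))) (at z)"
  shows "harmonic_on u T"
proof -
  have p1: "partial v u z = Re (f z * v)" if "z \<in> T" for v z
    using frechet_derivative_at[OF u[OF that]] unfolding partial_def by metis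
  have f': "(f has_field_derivative deriv f z) (at z)" if "z \<in> T" for z
    using assms(1,2) that holomorphic_derivI by blast
  have d: "(partial v u has_derivative (\<lambda>h. Re (deriv f z * h * v))) (at z)" if "z \<in> T" for v z
  proof (rule has_derivative_transform_within_open[where f = "\<lambda>z. Re (f z * v)" and s = T])
    have "(f has_derivative (*) (deriv f z)) (at z)"
      using f'[OF that] by (simp add: has_field_derivative_def)
    then show "((\<lambda>z. Re (f z * v)) has_derivative (\<lambda>h. Re (deriv f z * h * v))) (at z)"
      by (auto intro!: derivative_eq_intros)
  qed (use assms(1) that p1 in auto)
  have p2: "partial w (partial v u) z = Re (deriv f z * w * v)" if "z \<in> T" for v w z
    using frechet_derivative_at[OF d[OF that]] unfolding partial_def by metis
  have "continuous_on T (deriv f)"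
    using assms(1,2) by (simp add: holomorphic_deriv holomorphic_on_imp_continuous_on)
  then have c: "continuous_on T (\<lambda>z. Re (deriv f z * w * v))" for v w
    by (intro continuous_intros)
  then have "continuous_on T (partial w (partial v u))" for v w
    using p2 by (subst continuous_on_cong[OF refl]) auto
  moreover have "partial v u differentiable (at z)" if "z \<in> T" for v z
    using d[OF that] differentiable_def by blast
  moreover have "u differentiable (at z)" if "z \<in> T" for z
    using u[OF that] differentiable_def by blast
  ultimately show ?thesis
    unfolding harmonic_on_def by (simp add: p2)
qed

text \<open>At the ends of \<open>{u..v}\<close> only continuity of \<psi> is required. This admits
  paths that end at roots, where the integrand is unbounded.\<close>

lemma integrand_antiderivative:
  fixes f :: "real \<Rightarrow> complex"
  assumes "(f has_integral I) {0..1}" and "{u..v} \<subseteq> {0..1}" and "u \<le> v"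
    and "finite k" and "continuous_on {u..v} \<psi>"
    and "\<And>t. t \<in> {u<..<v} - k \<Longrightarrow> (\<psi> has_vector_derivative f t) (at t)"
  shows "integral {0..v} f - integral {0..u} f = \<psi> v - \<psi> u"
proof -
  have "(f has_integral (\<psi> v - \<psi> u)) {u..v}"
    using assms by (intro fundamental_theorem_of_calculus_interior_strong[where S=k]) auto
  moreover have "f integrable_on {0..v}"
    using has_integral_integrable[OF assms(1)] assms(2,3)
    by (rule_tac integrable_subinterval_real[where a=0 and b=1]) auto
  then have "integral {0..u} f + integral {u..v} f = integral {0..v} f"
    using assms(2,3) by (intro Henstock_Kurzweil_Integration.integral_combine) auto
  ultimately show ?thesis by (auto simp: algebra_simps dest: integral_unique)
qed

section \<open>Integrability near simple roots\<close>

text \<open>Dyadic domination: where (1/2)^(j+1) < |z - a| <= (1/2)^j the function is at most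
  2^(j+1). The disks of radius (1/2)^k, weighted by 2^(k+1), have masses 2 pi (1/2)^k, which are
  summable.\<close>

lemma integrable_inverse_norm_cball:
  fixes a :: complex
  shows "integrable lborel (\<lambda>z. indicator (cball a 1) z * (1 / cmod (z - a)))"
proof (rule integrableI_bounded)
  let ?f = "\<lambda>k z. ennreal (2 ^ Suc k) * indicator (cball a ((1/2) ^ k)) z"
  have le: "ennreal (norm (indicator (cball a 1) z * (1 / cmod (z - a)))) \<le> (\<Sum>k. ?f k z)" for z
  proof (cases "z \<in> cball a 1 \<and> z \<noteq> a")
    case True
    define k where "k = (LEAST k. (1/2) ^ k < cmod (z - a))"
    obtain k0 where "(1/2) ^ k0 < cmod (z - a)"
      using real_arch_pow_inv[of "cmod (z - a)" "1/2"] True by auto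
    then have k: "(1/2) ^ k < cmod (z - a)" unfolding k_def by (rule LeastI)
    have "cmod (z - a) \<le> 1" using True by (simp add: dist_norm norm_minus_commute)
    with k have "k \<noteq> 0" by (intro notI) simp
    then obtain j where j: "k = Suc j" using not0_implies_Suc by blast
    have "\<not> (1/2) ^ j < cmod (z - a)" using not_less_Least[of j "\<lambda>k. (1/2) ^ k < cmod (z - a)"] j
      unfolding k_def by linarith
    then have "z \<in> cball a ((1/2) ^ j)" by (simp add: dist_norm norm_minus_commute)
    moreover have "1 / cmod (z - a) \<le> 2 ^ Suc j"
      using k True unfolding j by (simp add: field_simps power_divide)
    ultimately have "ennreal (norm (indicator (cball a 1) z * (1 / cmod (z - a)))) \<le> ?f j z"
      using True by (auto simp: ennreal_leI)
    also have "\<dots> \<le> (\<Sum>k. ?f k z)"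
    proof -
      have "(\<Sum>k\<in>{j}. ?f k z) \<le> (\<Sum>k. ?f k z)" by (rule sum_le_suminf) auto
      then show ?thesis by (simp only: sum.insert sum.empty finite.emptyI empty_iff not_False_eq_True add_0_right)
    qed
    finally show ?thesis .
  next
    case False
    then have "indicator (cball a 1) z * (1 / cmod (z - a)) = 0" by (auto simp: indicator_def)
    then show ?thesis by (simp only: norm_zero ennreal_0 zero_le)
  qed
  have "(\<integral>\<^sup>+z. ennreal (norm (indicator (cball a 1) z * (1 / cmod (z - a)))) \<partial>lborel)
      \<le> (\<integral>\<^sup>+z. (\<Sum>k. ?f k z) \<partial>lborel)"
    by (intro nn_integral_mono le)
  also have "\<dots> = (\<Sum>k. \<integral>\<^sup>+z. ?f k z \<partial>lborel)"
    by (intro nn_integral_suminf borel_measurable_times_ennreal borel_measurable_indicator) auto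
  also have "\<dots> = (\<Sum>k. ennreal (2 * pi * (1/2) ^ k))"
  proof (rule suminf_cong)
    fix k :: nat
    have "2 ^ Suc k * (pi * ((1/2) ^ k)\<^sup>2) = 2 * pi * (1/2::real) ^ k"
      by (simp add: power2_eq_square power_divide field_simps)
    then show "(\<integral>\<^sup>+z. ?f k z \<partial>lborel) = ennreal (2 * pi * (1/2) ^ k)"
      by (simp add: nn_integral_cmult_indicator emeasure_cball unit_ball_vol_2 flip: ennreal_mult')
  qed
  also have "\<dots> < \<infinity>"
  proof -
    have "summable (\<lambda>k. 2 * pi * (1/2::real) ^ k)" by (intro summable_mult summable_geometric) simp
    then show ?thesis by (subst suminf_ennreal2) auto
  qed
  finally show "(\<integral>\<^sup>+z. ennreal (norm (indicator (cball a 1) z * (1 / cmod (z - a)))) \<partial>lborel) < \<infinity>" .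
  have "(\<lambda>z. 1 / cmod (z - a)) \<in> borel_measurable lborel" by measurable
  then show "(\<lambda>z. indicator (cball a 1) z * (1 / cmod (z - a))) \<in> borel_measurable lborel"
    by (intro borel_measurable_times borel_measurable_indicator) auto
qed

lemma set_integrable_inverse_norm:
  assumes "open B" and "bounded B"
  shows "set_integrable lborel B (\<lambda>z::complex. 1 / cmod (z - a))"
proof (unfold set_integrable_def, rule Bochner_Integration.integrable_bound)
  have "emeasure lborel B < \<infinity>" using assms(2) emeasure_bounded_finite by auto
  then have "integrable lborel (\<lambda>z. indicator B z :: real)"
    using assms(1) by (simp add: integrable_indicator_iff less_top)
  then show "integrable lborel (\<lambda>z. indicator B z + indicator (cball a 1) z * (1 / cmod (z - a)))"
    using integrable_inverse_norm_cball by (rule Bochner_Integration.integrable_add)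
  have "1 / cmod (z - a) \<le> 1" if "\<not> dist a z \<le> 1" for z
    using that by (simp add: dist_norm norm_minus_commute divide_le_eq_1)
  then show "AE z in lborel. norm (indicator B z *\<^sub>R (1 / cmod (z - a)))
      \<le> norm (indicator B z + indicator (cball a 1) z * (1 / cmod (z - a)))"
    by (intro AE_I2) (auto simp: indicator_def)
  have "(\<lambda>z. 1 / cmod (z - a)) \<in> borel_measurable lborel" by measurable
  then show "(\<lambda>z. indicator B z *\<^sub>R (1 / cmod (z - a))) \<in> borel_measurable lborel"
    using assms(1) by (intro borel_measurable_scaleR borel_measurable_indicator) auto
qed

text \<open>Partial fractions as an inequality: |a - x| <= |z - a| + |z - x|, divided by all three
  distances, splits 1 / (|z - a| |z - x|) into multiples of 1 / |z - a| and 1 / |z - x|. The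
  induction carries nonnegativity of \<open>c\<close> so that this estimate can be multiplied by
  \<open>c a\<close>.\<close>

lemma inverse_prod_norm_bound:
  fixes R :: "complex set"
  assumes "finite R" and "R \<noteq> {}"
  shows "\<exists>c. \<forall>z. z \<notin> R \<longrightarrow> 1 / (\<Prod>a\<in>R. cmod (z - a)) \<le> (\<Sum>a\<in>R. c a / cmod (z - a))"
proof -
  have "\<exists>c. (\<forall>a. c a \<ge> 0) \<and> (\<forall>z. z \<notin> R \<longrightarrow> 1 / (\<Prod>a\<in>R. cmod (z - a)) \<le> (\<Sum>a\<in>R. c a / cmod (z - a)))"
    using assms
  proof (induction R rule: finite_ne_induct)
    case (singleton x)
    then show ?case by (intro exI[of _ "\<lambda>_. 1"]) auto
  next
    case (insert x F)
    then obtain c where c0: "\<And>a. c a \<ge> 0"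
      and c: "\<And>z. z \<notin> F \<Longrightarrow> 1 / (\<Prod>a\<in>F. cmod (z - a)) \<le> (\<Sum>a\<in>F. c a / cmod (z - a))"
      by auto
    define c' where "c' = (\<lambda>a. if a = x then (\<Sum>b\<in>F. c b / cmod (b - x)) else c a / cmod (a - x))"
    have "1 / (\<Prod>a\<in>insert x F. cmod (z - a)) \<le> (\<Sum>a\<in>insert x F. c' a / cmod (z - a))"
      if z: "z \<notin> insert x F" for z
    proof -
      have "1 / (\<Prod>a\<in>insert x F. cmod (z - a)) = 1 / (\<Prod>a\<in>F. cmod (z - a)) / cmod (z - x)"
        using insert.hyps by (simp add: field_simps)
      also have "\<dots> \<le> (\<Sum>a\<in>F. c a / cmod (z - a)) / cmod (z - x)"
        using c z by (intro divide_right_mono) auto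
      also have "\<dots> = (\<Sum>a\<in>F. c a / cmod (z - a) / cmod (z - x))"
        by (simp add: sum_divide_distrib)
      also have "\<dots> \<le> (\<Sum>a\<in>F. c a / cmod (a - x) * (1 / cmod (z - x) + 1 / cmod (z - a)))"
      proof (rule sum_mono)
        fix a assume "a \<in> F"
        then have pos: "cmod (a - x) > 0" "cmod (z - a) > 0" "cmod (z - x) > 0"
          using z insert.hyps by auto
        have "c a * cmod (a - x) \<le> c a * (cmod (z - a) + cmod (z - x))"
          using norm_triangle_ineq4[of "z - x" "z - a"] c0 by (intro mult_left_mono) auto
        then show "c a / cmod (z - a) / cmod (z - x)
            \<le> c a / cmod (a - x) * (1 / cmod (z - x) + 1 / cmod (z - a))"
          using pos by (simp add: field_simps)
      qed
      also have "\<dots> = (\<Sum>b\<in>F. c b / cmod (b - x)) / cmod (z - x) + (\<Sum>a\<in>F. c a / cmod (a - x) / cmod (z - a))"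
        by (simp add: sum.distrib distrib_left sum_divide_distrib)
      also have "\<dots> = (\<Sum>a\<in>insert x F. c' a / cmod (z - a))"
      proof -
        have "(\<Sum>a\<in>F. c a / cmod (a - x) / cmod (z - a)) = (\<Sum>a\<in>F. c' a / cmod (z - a))"
          using insert.hyps by (intro sum.cong) (auto simp: c'_def)
        then show ?thesis using insert.hyps by (simp add: c'_def)
      qed
      finally show ?thesis .
    qed
    moreover have "c' a \<ge> 0" for a
      using c0 by (auto simp: c'_def intro!: sum_nonneg divide_nonneg_nonneg)
    ultimately show ?case by blast
  qed
  then show ?thesis by blast
qed

text \<open>This supplies the finite energy condition: a function with differential Re (V dz / sqrt
  D) has squared gradient |V|^2 / |D|, and simple roots produce only singularities of type 1 / |z -
  a|, integrable in the plane.\<close>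

lemma set_integrable_quotient_simple_roots:
  assumes "finite R" and "R \<noteq> {}" and "open B" and "bounded B" and "B \<inter> R = {}"
    and "continuous_on UNIV V"
  shows "set_integrable lebesgue B (\<lambda>z. (cmod (V z))\<^sup>2 / (\<Prod>a\<in>R. cmod (z - a)))"
proof -
  let ?h = "\<lambda>z. (cmod (V z))\<^sup>2 / (\<Prod>a\<in>R. cmod (z - a))"
  obtain c where c: "\<And>z. z \<notin> R \<Longrightarrow> 1 / (\<Prod>a\<in>R. cmod (z - a)) \<le> (\<Sum>a\<in>R. c a / cmod (z - a))"
    using inverse_prod_norm_bound[OF assms(1,2)] by blast
  have "compact (V ` closure B)"
    using assms(4,6) by (intro compact_continuous_image) (auto intro: continuous_on_subset)
  then obtain M where M: "\<And>z. z \<in> closure B \<Longrightarrow> cmod (V z) \<le> M"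
    unfolding compact_eq_bounded_closed bounded_iff by blast
  have nz: "\<forall>z\<in>B. (\<Prod>a\<in>R. cmod (z - a)) \<noteq> 0" using assms(1,5) by auto
  have meas: "(\<lambda>z. indicator B z *\<^sub>R ?h z) \<in> borel_measurable borel"
    using nz assms(3,6)
    by (intro borel_measurable_continuous_on_indicator continuous_intros)
       (auto intro: continuous_on_subset)
  have "set_integrable lborel B ?h"
  proof (rule set_integrable_bound)
    have "set_integrable lborel B (\<lambda>z. c a / cmod (z - a))" for a
      using set_integrable_mult_right[OF set_integrable_inverse_norm[OF assms(3,4), of a], of "c a"] by simp
    then have "set_integrable lborel B (\<lambda>z. \<Sum>a\<in>R. c a / cmod (z - a))"
      unfolding set_integrable_def scaleR_sum_right by (rule Bochner_Integration.integrable_sum)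
    then show "set_integrable lborel B (\<lambda>z. M\<^sup>2 * (\<Sum>a\<in>R. c a / cmod (z - a)))"
      by (intro set_integrable_mult_right) auto
    show "set_borel_measurable lborel B ?h"
      using meas unfolding set_borel_measurable_def by simp
    have "norm (?h z) \<le> norm (M\<^sup>2 * (\<Sum>a\<in>R. c a / cmod (z - a)))" if "z \<in> B" for z
    proof -
      have "norm (?h z) = (cmod (V z))\<^sup>2 * (1 / (\<Prod>a\<in>R. cmod (z - a)))"
        by (simp add: prod_nonneg)
      also have "\<dots> \<le> M\<^sup>2 * (\<Sum>a\<in>R. c a / cmod (z - a))"
        using that M closure_subset c[of z] assms(5)
        by (intro mult_mono power_mono) (auto intro: prod_nonneg)
      finally show ?thesis by simp
    qed
    then show "AE z in lborel. z \<in> B \<longrightarrow> norm (?h z) \<le> norm (M\<^sup>2 * (\<Sum>a\<in>R. c a / cmod (z - a)))"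
      by auto
  qed
  then show ?thesis
    using meas unfolding set_integrable_def by (simp add: integrable_completion)
qed

section \<open>Solutions of the Pell equation and the harmonic function\<close>

lemma has_derivative_ln_norm:
  fixes E :: "'a::real_normed_vector \<Rightarrow> complex"
  assumes "(E has_derivative E') (at x)" and "E x \<noteq> 0"
  shows "((\<lambda>y. ln (cmod (E y))) has_derivative (\<lambda>h. Re (E' h / E x))) (at x)"
proof -
  have "((\<lambda>y. cmod (E y)) has_derivative (\<lambda>h. E' h \<bullet> sgn (E x))) (at x)"
    using has_derivative_compose[OF assms(1) has_derivative_norm[OF assms(2)]] .
  moreover have "(ln has_derivative (*) (1 / cmod (E x))) (at (cmod (E x)))"
    using assms(2) DERIV_ln_divide[of "cmod (E x)"] by (simp add: has_field_derivative_def)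
  ultimately have "((\<lambda>y. ln (cmod (E y))) has_derivative (\<lambda>h. 1 / cmod (E x) * (E' h \<bullet> sgn (E x)))) (at x)"
    using has_derivative_compose by blast
  also have "(\<lambda>h. 1 / cmod (E x) * (E' h \<bullet> sgn (E x))) = (\<lambda>h. Re (E' h / E x))"
  proof
    fix h
    have "cmod (E x) * cmod (E x) = Re (E x) * Re (E x) + Im (E x) * Im (E x)"
      using cmod_power2[of "E x"] by (simp add: power2_eq_square)
    then show "1 / cmod (E x) * (E' h \<bullet> sgn (E x)) = Re (E' h / E x)"
      using assms(2) by (simp add: inner_complex_def sgn_eq Re_divide power2_eq_square add_divide_distrib mult.commute)
  qed
  finally show ?thesis .
qed

lemma has_derivative_poly_compose:
  fixes g :: "'a::real_normed_vector \<Rightarrow> complex"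
  assumes "(g has_derivative g') (at x within S)"
  shows "((\<lambda>y. poly p (g y)) has_derivative (\<lambda>h. poly (pderiv p) (g x) * g' h)) (at x within S)"
  using has_derivative_compose[OF assms, of "poly p" "(*) (poly (pderiv p) (g x))"]
    poly_DERIV[of p "g x"] by (simp add: has_field_derivative_def)

text \<open>With E = p + q r the two identities give p' = (V / r) q r and q' r + q D' / (2 r) = (V /
  r) p. Their sum is the logarithmic derivative V / r of E.\<close>

lemma pell_has_derivative:
  fixes g r :: "'a::real_normed_vector \<Rightarrow> complex"
  assumes "(g has_derivative g') (at x within S)"
    and "continuous (at x within S) r" and "x \<in> S" and "r x \<noteq> 0"
    and "\<And>y. y \<in> S \<Longrightarrow> (r y)\<^sup>2 = poly D (g y)"
    and p': "pderiv p = q * V" and q': "2 * (p * V) = 2 * (pderiv q * D) + q * pderiv D"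
  shows "((\<lambda>y. poly p (g y) + poly q (g y) * r y) has_derivative
           (\<lambda>h. poly V (g x) / r x * g' h * (poly p (g x) + poly q (g x) * r x))) (at x within S)"
proof -
  note dp = has_derivative_poly_compose[OF assms(1)]
  have dr: "(r has_derivative (\<lambda>h. poly (pderiv D) (g x) * g' h / (2 * r x))) (at x within S)"
    by (rule has_derivative_sqrt_branch[OF assms(2-5) dp])
  have rx: "r x * r x = poly D (g x)" using assms(3,5) by (simp add: power2_eq_square)
  have pv: "poly (pderiv p) (g x) = poly q (g x) * poly V (g x)" using p' by simp
  have "poly (2 * (p * V)) (g x) = poly (2 * (pderiv q * D) + q * pderiv D) (g x)" by (simp only: q')
  then have qv: "poly q (g x) * poly (pderiv D) (g x) =
      2 * (poly p (g x) * poly V (g x)) - 2 * (poly (pderiv q) (g x) * (r x * r x))"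
    by (simp add: rx)
  have eq: "poly (pderiv p) (g x) * k + (poly q (g x) * (poly (pderiv D) (g x) * k / (2 * r x))
      + poly (pderiv q) (g x) * k * r x)
      = poly V (g x) / r x * k * (poly p (g x) + poly q (g x) * r x)" for k
  proof -
    have "poly q (g x) * (poly (pderiv D) (g x) * k / (2 * r x))
      = (poly q (g x) * poly (pderiv D) (g x)) * k / (2 * r x)" by simp
    also have "\<dots> = poly p (g x) * poly V (g x) * k / r x - poly (pderiv q) (g x) * k * r x"
      unfolding qv using assms(4) by (simp add: field_simps)
    finally show ?thesis using assms(4) by (simp add: pv field_simps)
  qed
  have "((\<lambda>y. poly p (g y) + poly q (g y) * r y) has_derivative
     (\<lambda>h. poly (pderiv p) (g x) * g' h + (poly q (g x) * (poly (pderiv D) (g x) * g' h / (2 * r x))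
      + poly (pderiv q) (g x) * g' h * r x))) (at x within S)"
    by (intro has_derivative_add dp has_derivative_mult dr)
  then show ?thesis by (simp only: eq)
qed

text \<open>Differentiating the Pell equation yields 2 p p' = q W. Multiplying 2 p' by 1 = p^2 - q^2
  D, a Bezout identity for p and q, then exhibits the factor q.\<close>

lemma pell_derivative_quotient:
  fixes p q D :: "complex poly"
  assumes pell: "p\<^sup>2 - q\<^sup>2 * D = 1" and "q \<noteq> 0"
  obtains V where "pderiv p = q * V" and "2 * (p * V) = 2 * (pderiv q * D) + q * pderiv D"
proof -
  define W where "W = 2 * (pderiv q * D) + q * pderiv D"
  have "pderiv (p\<^sup>2 - q\<^sup>2 * D) = 0" by (simp add: pell)
  then have pp: "2 * (p * pderiv p) = q * W"
    by (simp add: W_def pderiv_diff pderiv_mult power2_eq_square algebra_simps)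
  have "2 * pderiv p = 2 * pderiv p * (p\<^sup>2 - q\<^sup>2 * D)" by (simp add: pell)
  also have "\<dots> = p * (2 * (p * pderiv p)) - q * (2 * (q * D * pderiv p))"
    by (simp add: algebra_simps power2_eq_square)
  also have "\<dots> = q * (p * W - 2 * (q * D * pderiv p))" unfolding pp by (simp add: algebra_simps)
  finally have two: "2 * pderiv p = q * (p * W - 2 * (q * D * pderiv p))" .
  define V where "V = smult (1/2) (p * W - 2 * (q * D * pderiv p))"
  have half: "smult (1/2) (2 * f) = f" for f :: "complex poly"
    by (simp add: numeral_poly)
  have 1: "pderiv p = q * V"
    using arg_cong[OF two, of "smult (1/2)"] unfolding half V_def by simp
  have "q * (2 * (p * V)) = q * W" using pp unfolding 1 by (simp add: algebra_simps)
  then have "2 * (p * V) = W" using \<open>q \<noteq> 0\<close> by simp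
  with 1 show ?thesis using that unfolding W_def by blast
qed

lemma sqrt_branch_has_field_derivative:
  fixes s f :: "complex \<Rightarrow> complex"
  assumes "open T" and "continuous_on T s" and "\<And>z. z \<in> T \<Longrightarrow> (s z)\<^sup>2 = f z"
    and "z \<in> T" and "s z \<noteq> 0" and "(f has_field_derivative f') (at z)"
  shows "(s has_field_derivative f' / (2 * s z)) (at z)"
proof -
  have "continuous (at z within T) s" using assms(2,4) by (simp add: continuous_on_eq_continuous_within)
  moreover have "(f has_derivative (*) f') (at z within T)"
    using assms(6) by (simp add: has_field_derivative_def has_derivative_at_withinI)
  ultimately have "(s has_derivative (\<lambda>h. f' * h / (2 * s z))) (at z within T)"
    using assms(3-5) by (intro has_derivative_sqrt_branch)
  moreover have "(\<lambda>h. f' * h / (2 * s z)) = (*) (f' / (2 * s z))" by auto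
  ultimately show ?thesis
    using assms(1,4) by (simp only: has_field_derivative_def at_within_open)
qed

text \<open>G is ln |p + q w| divided by m. It is odd in w because p + q w and p - q w are inverse
  to each other, and \<open>lead\<close> says that p + q w is the growing one of the two in the
  trivialization at infinity.\<close>

lemma is_U_if_pell:
  assumes "finite R" and "R \<noteq> {}" and D: "D = (\<Prod>a\<in>R. [:-a, 1:])" and card: "card R = 2 * n"
    and pell: "p\<^sup>2 - q\<^sup>2 * D = 1" and "q \<noteq> 0"
    and p': "pderiv p = q * V" and q': "2 * (p * V) = 2 * (pderiv q * D) + q * pderiv D"
    and lead: "lead_coeff p + lead_coeff q \<noteq> 0"
  shows "is_U D (poly V)"
proof -
  define m where "m = degree p"
  define G where "G = (\<lambda>z w. ln (cmod (poly p z + poly q z * w)) / real m)"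
  have degD: "degree D = 2 * n"
    unfolding D using card by (subst degree_prod_eq_sum_degree) auto
  have leadD: "lead_coeff D = 1" unfolding D by (simp add: lead_coeff_prod)
  have n: "n > 0" using card assms(1,2) by (metis card_gt_0_iff mult_0_right neq0_conv)
  have D0: "D \<noteq> 0" using leadD by auto
  \<comment> \<open>Degrees in p^2 = 1 + q^2 D, where the constant is of lower order since n > 0.
    Hence p and q sqrt D have the same order of growth m.\<close>
  have m: "m = degree q + n"
  proof -
    have "degree (q\<^sup>2 * D) = 2 * degree q + 2 * n"
      using \<open>q \<noteq> 0\<close> D0 degD by (simp add: degree_mult_eq degree_power_eq)
    then have "degree (1 + q\<^sup>2 * D) = 2 * degree q + 2 * n"
      using n by (subst degree_add_eq_right) auto
    moreover have "p\<^sup>2 = 1 + q\<^sup>2 * D" using pell by (simp add: algebra_simps)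
    moreover have "degree (p\<^sup>2) = 2 * m" by (cases "p = 0") (auto simp: degree_power_eq m_def)
    ultimately show ?thesis by simp
  qed
  have pellz: "(poly p z)\<^sup>2 - (poly q z)\<^sup>2 * poly D z = 1" for z
    using arg_cong[OF pell, of "\<lambda>f. poly f z"] by simp
  have conj: "(poly p z + poly q z * w) * (poly p z + poly q z * (- w)) = 1" if "w\<^sup>2 = poly D z" for z w
    using pellz[of z] that by (simp add: algebra_simps power2_eq_square)
  have nz: "poly p z + poly q z * w \<noteq> 0" if "w\<^sup>2 = poly D z" for z w
    using conj[OF that] by auto
  have dG: "((\<lambda>\<zeta>. G \<zeta> (s \<zeta>)) has_derivative (\<lambda>h. Re (poly V z / of_nat m * h / s z))) (at z)"
    if "sqrt_branch D T s" "z \<in> T" for T s z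
  proof -
    have T: "open T" "continuous_on T s" "\<And>z. z \<in> T \<Longrightarrow> poly D z \<noteq> 0" "\<And>z. z \<in> T \<Longrightarrow> (s z)\<^sup>2 = poly D z"
      using that(1) unfolding sqrt_branch_def by auto
    let ?E = "\<lambda>\<zeta>. poly p \<zeta> + poly q \<zeta> * s \<zeta>"
    have sz: "s z \<noteq> 0" using T(3,4) that(2) by force
    have "(?E has_derivative (\<lambda>h. poly V z / s z * h * ?E z)) (at z within T)"
      using T(2,4) that(2) sz
      by (intro pell_has_derivative[OF _ _ _ _ _ p' q']) (auto simp: continuous_on_eq_continuous_within)
    then have "(?E has_derivative (\<lambda>h. poly V z / s z * h * ?E z)) (at z)"
      using T(1) that(2) at_within_open by metis
    then have "((\<lambda>y. ln (cmod (?E y))) has_derivative (\<lambda>h. Re (poly V z / s z * h * ?E z / ?E z))) (at z)"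
      using nz[OF T(4)[OF that(2)]] by (rule has_derivative_ln_norm)
    then have "((\<lambda>y. G y (s y)) has_derivative (\<lambda>h. Re (poly V z / s z * h * ?E z / ?E z) / real m)) (at z)"
      unfolding G_def divide_inverse[of _ "real m"] by (rule has_derivative_mult_left)
    also have "(\<lambda>h. Re (poly V z / s z * h * ?E z / ?E z) / real m) = (\<lambda>h. Re (poly V z / of_nat m * h / s z))"
    proof
      fix h
      have "Re (poly V z / of_nat m * h / s z) = Re (poly V z / s z * h / of_nat m)" by (simp add: field_simps)
      also have "\<dots> = Re (poly V z / s z * h) / real m" by (rule Re_divide_of_nat)
      finally show "Re (poly V z / s z * h * ?E z / ?E z) / real m = Re (poly V z / of_nat m * h / s z)"
        using nz[OF T(4)[OF that(2)]] by simp
    qed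
    finally show ?thesis .
  qed
  have grad: "grad_norm_sq D G z = (cmod (poly V z / of_nat m))\<^sup>2 / (\<Prod>a\<in>R. cmod (z - a))"
    if "poly D z \<noteq> 0" for z
  proof -
    \<comment> \<open>The branch used in \<open>grad_norm_sq\<close> becomes a
      \<open>sqrt_branch\<close> on the set where the quotient avoids the cut of
      \<open>csqrt\<close>; then \<open>dG\<close> applies to it.\<close>
    define T where "T = (\<lambda>\<zeta>. poly D \<zeta> / poly D z) -` (- \<real>\<^sub>\<le>\<^sub>0)"
    define s where "s = (\<lambda>\<zeta>. csqrt (poly D z) * csqrt (poly D \<zeta> / poly D z))"
    have "open T" unfolding T_def
      by (intro open_vimage open_Compl closed_nonpos_Reals_complex continuous_intros) (use that in auto)
    moreover have "s holomorphic_on T" unfolding s_def T_def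
      using that by (intro holomorphic_intros) auto
    then have "continuous_on T s" by (rule holomorphic_on_imp_continuous_on)
    ultimately have "sqrt_branch D T s"
      unfolding sqrt_branch_def using that by (auto simp: T_def s_def power_mult_distrib)
    moreover have zT: "z \<in> T" using that by (simp add: T_def)
    ultimately have d: "((\<lambda>\<zeta>. G \<zeta> (s \<zeta>)) has_derivative (\<lambda>h. Re (poly V z / of_nat m * h / s z))) (at z)"
      by (rule dG)
    let ?v = "poly V z / of_nat m / s z"
    have s_eq: "(\<lambda>\<zeta>. G \<zeta> (csqrt (poly D z) * csqrt (poly D \<zeta> / poly D z))) = (\<lambda>\<zeta>. G \<zeta> (s \<zeta>))"
      by (simp only: s_def)
    have "grad_norm_sq D G z = (Re (poly V z / of_nat m * 1 / s z))\<^sup>2 + (Re (poly V z / of_nat m * \<i> / s z))\<^sup>2"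
      unfolding grad_norm_sq_def partial_def Let_def
      by (simp only: s_eq frechet_derivative_at[OF d, symmetric])
    also have "\<dots> = (Re ?v)\<^sup>2 + (Re (\<i> * ?v))\<^sup>2" by (simp only: mult_1_right times_divide_eq_left times_divide_eq_right mult.commute[of \<i>])
    also have "\<dots> = (cmod ?v)\<^sup>2" by (simp only: cmod_power2 Re_i_times power2_minus)
    also have "\<dots> = (cmod (poly V z / of_nat m))\<^sup>2 / cmod ((s z)\<^sup>2)"
      by (simp only: norm_divide power_divide norm_power)
    also have "(s z)\<^sup>2 = poly D z" using that by (simp add: s_def power_mult_distrib)
    also have "cmod (poly D z) = (\<Prod>a\<in>R. cmod (z - a))"
      unfolding D by (simp add: poly_prod prod_norm)
    finally show ?thesis .
  qed
  have roots: "poly D z = 0 \<longleftrightarrow> z \<in> R" for z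
    unfolding D using assms(1) by (auto simp: poly_prod)
  have holV: "(\<lambda>z. poly V z / of_nat m) holomorphic_on UNIV"
    by (intro holomorphic_intros) (use m n in auto)
  have "Z2_harmonic D G"
    unfolding Z2_harmonic_def
  proof (intro conjI allI impI)
    show "line_bundle_section D G"
      unfolding line_bundle_section_def
    proof (intro allI impI)
      fix z w assume "w\<^sup>2 = poly D z"
      then have "poly p z + poly q z * (- w) = inverse (poly p z + poly q z * w)"
        using inverse_unique[OF conj[OF \<open>w\<^sup>2 = poly D z\<close>]] by simp
      then show "G z (- w) = - G z w"
        unfolding G_def using nz[OF \<open>w\<^sup>2 = poly D z\<close>] by (simp add: norm_inverse ln_inverse del: mult_minus_right)
    qed
  next
    fix T s assume s: "sqrt_branch D T s"
    then have T: "open T" "continuous_on T s" "\<And>z. z \<in> T \<Longrightarrow> poly D z \<noteq> 0" "\<And>z. z \<in> T \<Longrightarrow> (s z)\<^sup>2 = poly D z"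
      unfolding sqrt_branch_def by auto
    have s0: "s z \<noteq> 0" if "z \<in> T" for z using T(3,4) that by force
    have "s holomorphic_on T"
    proof -
      have "(s has_field_derivative poly (pderiv D) z / (2 * s z)) (at z)" if "z \<in> T" for z
        by (rule sqrt_branch_has_field_derivative[OF T(1,2) T(4) that s0[OF that] poly_DERIV])
      then show ?thesis using T(1) by (auto simp: holomorphic_on_open)
    qed
    then have "(\<lambda>z. poly V z / of_nat m / s z) holomorphic_on T"
      by (intro holomorphic_intros) (use m n s0 in auto)
    then show "harmonic_on (\<lambda>z. G z (s z)) T"
    proof (rule harmonic_on_if_Re_derivative[OF T(1)])
      fix z assume "z \<in> T"
      then show "((\<lambda>z. G z (s z)) has_derivative (\<lambda>h. Re (poly V z / of_nat m / s z * h))) (at z)"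
        using dG[OF s] by (simp add: mult.commute)
    qed
  next
    fix B assume B: "open B" "bounded B" "B \<subseteq> {z. poly D z \<noteq> 0}"
    have "set_integrable lebesgue B (\<lambda>z. (cmod (poly V z / of_nat m))\<^sup>2 / (\<Prod>a\<in>R. cmod (z - a)))"
      using B roots holV
      by (intro set_integrable_quotient_simple_roots assms(1,2) holomorphic_on_imp_continuous_on) auto
    then show "set_integrable lebesgue B (grad_norm_sq D G)"
      using B(3) by (subst set_integrable_cong[OF refl refl grad]) auto
  qed
  moreover have "((\<lambda>z. G z (sqrt_at_infinity D z) - ln (cmod z)) \<longlongrightarrow> ln (cmod (lead_coeff p + lead_coeff q)) / real m) at_infinity"
  proof -
    \<comment> \<open>This is p + q sqrt D divided by z^m; its limit is the sum of the leading
      coefficients, nonzero by \<open>lead\<close>.\<close>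
    let ?f = "\<lambda>z. poly p z / z ^ degree p + poly q z / z ^ degree q * csqrt (poly D z / z ^ degree D)"
    have "((\<lambda>z. poly D z / z ^ degree D) \<longlongrightarrow> 1) at_infinity"
      using poly_divide_tendsto_aux[of D] leadD by simp
    then have "((\<lambda>z. csqrt (poly D z / z ^ degree D)) \<longlongrightarrow> csqrt 1) at_infinity"
      by (rule isCont_tendsto_compose[rotated]) (auto intro: continuous_at_csqrt)
    then have "(?f \<longlongrightarrow> lead_coeff p + lead_coeff q * csqrt 1) at_infinity"
      by (intro tendsto_intros poly_divide_tendsto_aux)
    then have "((\<lambda>z. ln (cmod (?f z)) / real m) \<longlongrightarrow> ln (cmod (lead_coeff p + lead_coeff q)) / real m) at_infinity"
      using lead m n by (intro tendsto_divide tendsto_ln tendsto_norm tendsto_const) auto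
    then show ?thesis
    proof (rule Lim_transform_eventually)
      show "\<forall>\<^sub>F z in at_infinity. ln (cmod (?f z)) / real m = G z (sqrt_at_infinity D z) - ln (cmod z)"
      proof (rule eventually_at_infinityI)
        fix z :: complex assume "1 \<le> cmod z"
        then have z: "z \<noteq> 0" by auto
        have sq: "(sqrt_at_infinity D z)\<^sup>2 = poly D z"
          using z degD by (simp add: sqrt_at_infinity_def power_mult_distrib flip: power_mult)
            (simp add: mult.commute)
        have eq: "poly p z + poly q z * sqrt_at_infinity D z = z ^ m * ?f z"
          using z by (simp add: sqrt_at_infinity_def degD m_def[symmetric] field_simps) (simp add: m power_add)
        then have "ln (cmod (poly p z + poly q z * sqrt_at_infinity D z)) = ln (cmod z ^ m * cmod (?f z))"
          by (simp add: norm_mult norm_power)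
        also have "\<dots> = real m * ln (cmod z) + ln (cmod (?f z))"
        proof -
          have "?f z \<noteq> 0" using nz[OF sq] eq by auto
          then show ?thesis using z by (subst ln_mult) (auto simp: ln_realpow)
        qed
        finally show "ln (cmod (?f z)) / real m = G z (sqrt_at_infinity D z) - ln (cmod z)"
          using m n by (simp add: G_def field_simps)
      qed
    qed
  qed
  moreover have m0: "m > 0" using m n by simp
  ultimately have "is_G D G" unfolding is_G_def by blast
  then have "is_U_D D (\<lambda>z. poly V z / of_nat m)"
    unfolding is_U_D_def using holV dG by blast
  then show ?thesis
    unfolding is_U_def using m0
    by (intro exI[of _ "\<lambda>z. poly V z / of_nat m"] exI[of _ "real m"]) (auto simp: fun_eq_iff)
qed

text \<open>E = p + q r has no zero along the path, so it has a continuous logarithm, which is an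
  antiderivative of the integrand. At both ends r = 0, hence E = p is 1 or -1, and twice the
  increment of the logarithm is a period of \<open>exp\<close>.\<close>

lemma pell_integral:
  assumes pell: "p\<^sup>2 - q\<^sup>2 * D = 1"
    and p': "pderiv p = q * V" and q': "2 * (p * V) = 2 * (pderiv q * D) + q * pderiv D"
    and "valid_path \<gamma>" and "poly D (pathstart \<gamma>) = 0" and "poly D (pathfinish \<gamma>) = 0"
    and D0: "\<forall>t\<in>{0<..<1}. poly D (\<gamma> t) \<noteq> 0" and r: "sqrt_along D \<gamma> r"
  shows "\<exists>m::int. has_integral_U_over_sqrt (poly V) r (of_int m * (of_real pi * \<i>)) \<gamma>"
proof -
  have rc: "continuous_on {0..1} r" and r2: "\<And>t. t \<in> {0..1} \<Longrightarrow> (r t)\<^sup>2 = poly D (\<gamma> t)"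
    using r unfolding sqrt_along_def by auto
  obtain k where k: "finite k" "\<gamma> C1_differentiable_on {0..1} - k" and gc: "continuous_on {0..1} \<gamma>"
    using assms(4) unfolding valid_path_def piecewise_C1_differentiable_on_def by auto
  define E where "E = (\<lambda>t. poly p (\<gamma> t) + poly q (\<gamma> t) * r t)"
  have pellz: "(poly p z)\<^sup>2 - (poly q z)\<^sup>2 * poly D z = 1" for z
    using arg_cong[OF pell, of "\<lambda>f. poly f z"] by simp
  have E0: "E t \<noteq> 0" if "t \<in> {0..1}" for t
  proof -
    have "E t * (poly p (\<gamma> t) - poly q (\<gamma> t) * r t) = 1"
      using pellz[of "\<gamma> t"] r2[OF that] by (simp add: E_def algebra_simps power2_eq_square)
    then show ?thesis by auto
  qed
  have "continuous_on {0..1} E" unfolding E_def by (intro continuous_intros rc gc)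
  then obtain L where Lc: "continuous_on {0..1} L" and L: "\<And>t. t \<in> {0..1} \<Longrightarrow> E t = exp (L t)"
    using continuous_logarithm_on_contractible[of "{0..1::real}" E] E0
    by (metis convex_imp_contractible convex_real_interval(5))
  let ?f = "\<lambda>t. poly V (\<gamma> t) / r t * vector_derivative \<gamma> (at t within {0..1})"
  have int: "(?f has_integral (L 1 - L 0)) {0..1}"
  proof (rule fundamental_theorem_of_calculus_interior_strong[OF k(1) _ _ Lc])
    fix t :: real assume t: "t \<in> {0<..<1} - k"
    then have t': "t \<in> {0..1}" by auto
    have "(\<gamma> has_vector_derivative vector_derivative \<gamma> (at t)) (at t)"
      using t k(2) by (auto simp: C1_differentiable_on_eq vector_derivative_works)
    moreover from this have vd: "vector_derivative \<gamma> (at t within {0..1}) = vector_derivative \<gamma> (at t)"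
      using t by (intro vector_derivative_at_within_ivl) auto
    ultimately have g: "(\<gamma> has_derivative (\<lambda>h. h *\<^sub>R vector_derivative \<gamma> (at t within {0..1}))) (at t within {0..1})"
      by (simp add: has_vector_derivative_def has_derivative_at_withinI)
    have rt: "r t \<noteq> 0" using D0 t r2[OF t'] by force
    have "(E has_derivative (\<lambda>h. poly V (\<gamma> t) / r t * (h *\<^sub>R vector_derivative \<gamma> (at t within {0..1})) * E t)) (at t within {0..1})"
      unfolding E_def
      by (rule pell_has_derivative[OF g _ t' rt r2 p' q'])
        (use rc t' in \<open>auto simp: continuous_on_eq_continuous_within\<close>)
    then have "(L has_derivative (\<lambda>h. poly V (\<gamma> t) / r t * (h *\<^sub>R vector_derivative \<gamma> (at t within {0..1})) * E t / E t)) (at t within {0..1})"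
      using Lc t' L by (intro has_derivative_log_branch) (auto simp: continuous_on_eq_continuous_within)
    moreover have "poly V (\<gamma> t) / r t * (h *\<^sub>R vector_derivative \<gamma> (at t within {0..1})) * E t / E t = h *\<^sub>R ?f t" for h
      by (simp only: nonzero_mult_div_cancel_right[OF E0[OF t']] mult_scaleR_right)
    ultimately have "(L has_derivative (\<lambda>h. h *\<^sub>R ?f t)) (at t within {0..1})" by simp
    then show "(L has_vector_derivative ?f t) (at t)"
      using at_within_Icc_at[of 0 t 1] t by (simp only: has_vector_derivative_def) auto
  qed simp
  have ends: "(exp (L t))\<^sup>2 = 1" if "t \<in> {0, 1}" for t
  proof -
    have "poly D (\<gamma> t) = 0" using that assms(5,6) by (auto simp: pathstart_def pathfinish_def)
    moreover from this have "r t = 0" using r2[of t] that by auto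
    moreover have "E t = exp (L t)" using L that by auto
    ultimately show ?thesis using pellz[of "\<gamma> t"] by (simp add: E_def)
  qed
  from ends[of 0] ends[of 1] have "exp (2 * (L 1 - L 0)) = 1"
    by (simp add: exp_diff exp_double right_diff_distrib)
  then obtain m :: int where "Re (2 * (L 1 - L 0)) = 0" "Im (2 * (L 1 - L 0)) = of_int (2 * m) * pi"
    unfolding exp_eq_1 by blast
  then have "L 1 - L 0 = of_int m * (of_real pi * \<i>)" by (intro complex_eqI) simp_all
  with int show ?thesis unfolding has_integral_U_over_sqrt_def by metis
qed

section \<open>The slit plane\<close>

lemma Nonpos_Reals_iff_real: "x \<in> \<real>\<^sub>\<le>\<^sub>0 \<longleftrightarrow> x \<in> \<real> \<and> Re x \<le> 0"
  by (auto simp: complex_nonpos_Reals_iff complex_is_Real_iff)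

text \<open>Contrapositive form of a geometric fact: the plane cut along the nonpositive reals is
  starlike about every positive real.\<close>

lemma nonpos_convex_combination:
  fixes y :: complex
  assumes "u *\<^sub>R of_real x + v *\<^sub>R y \<in> \<real>\<^sub>\<le>\<^sub>0" and "0 \<le> u" and "0 \<le> v" and "u + v = 1" and "0 < x"
  shows "y \<in> \<real>\<^sub>\<le>\<^sub>0"
proof -
  have v: "v > 0"
  proof (rule ccontr)
    assume "\<not> v > 0"
    then have "v = 0" "u = 1" using assms by auto
    then show False using assms by (simp add: complex_nonpos_Reals_iff)
  qed
  have "u * x + v * Re y \<le> 0" "v * Im y = 0" using assms by (auto simp: complex_nonpos_Reals_iff)
  moreover have "0 \<le> u * x" using assms by simp
  ultimately have "v * Re y \<le> 0" "Im y = 0" using v by auto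
  then show ?thesis using v by (auto simp: complex_nonpos_Reals_iff mult_le_0_iff)
qed

lemma generic_base_point:
  fixes R :: "complex set"
  assumes "finite R"
  obtains b where "\<And>a c. a \<in> R \<Longrightarrow> c \<in> R \<Longrightarrow> a \<noteq> c \<Longrightarrow> Im ((a - b) / (c - b)) \<noteq> 0"
proof -
  let ?P = "{(a, c). a \<in> R \<and> c \<in> R \<and> a \<noteq> c}"
  \<comment> \<open>The line through \<open>a\<close> and \<open>c\<close>, that is Im ((a - b) *
    cnj (c - b)) = 0, expanded as a hyperplane equation in \<open>b\<close>. Finitely many lines
    have measure zero.\<close>
  let ?L = "\<lambda>(a, c). {b. Complex (Im a - Im c) (Re c - Re a) \<bullet> b = Im (a * cnj c)}"
  have "negligible (\<Union> (?L ` ?P))"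
  proof (rule negligible_Union)
    have "?P \<subseteq> R \<times> R" by auto
    then show "finite (?L ` ?P)" using assms finite_subset by blast
    fix T assume "T \<in> ?L ` ?P"
    then obtain a c where "a \<noteq> c" "T = ?L (a, c)" by auto
    moreover have "Complex (Im a - Im c) (Re c - Re a) \<noteq> 0" using \<open>a \<noteq> c\<close> by (auto simp: complex_eq_iff)
    ultimately show "negligible T" by (auto intro: negligible_hyperplane)
  qed
  then have "\<Union> (?L ` ?P) \<noteq> UNIV" using non_negligible_UNIV by metis
  then obtain b where b: "b \<notin> \<Union> (?L ` ?P)" by blast
  have "Im ((a - b) / (c - b)) \<noteq> 0" if "a \<in> R" "c \<in> R" "a \<noteq> c" for a c
  proof -
    have "Complex (Im a - Im c) (Re c - Re a) \<bullet> b \<noteq> Im (a * cnj c)" using b that by blast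
    then have "Im ((a - b) * cnj (c - b)) \<noteq> 0" by (simp add: inner_complex_def algebra_simps)
    moreover from this have "c \<noteq> b" by auto
    ultimately show ?thesis by (simp add: complex_div_cnj[of "a - b"])
  qed
  then show ?thesis using that by blast
qed

text \<open>
  The slits are the rays \<open>{b + t (a - b) | t \<ge> 1}\<close> for the roots \<open>a\<close>; on the slit of \<open>a\<close>, and only
  there, \<open>coord a\<close> is real and nonpositive. No line through \<open>b\<close> contains two roots, hence the slits are
  disjoint, and \<open>sector a\<close>, an intersection of half planes bounded by lines through \<open>b\<close>, is a convex
  cone that contains the slit of \<open>a\<close> and meets no other one. The map \<open>square_chart a\<close> inverts
  \<open>y\<^sup>2 = coord a z\<close>; in the variable \<open>y\<close> a primitive of \<open>U / sqrt D\<close> is holomorphic at the root and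
  across the slit, and odd up to its value \<open>e a\<close> at the root.
\<close>

locale slit_plane =
  fixes R :: "complex set" and b :: complex
  assumes finite_R: "finite R" and card_R: "2 \<le> card R"
    and generic: "\<And>a c. a \<in> R \<Longrightarrow> c \<in> R \<Longrightarrow> a \<noteq> c \<Longrightarrow> Im ((a - b) / (c - b)) \<noteq> 0"
begin

definition coord :: "complex \<Rightarrow> complex \<Rightarrow> complex" where
  "coord a z = 1 - (z - b) / (a - b)"

definition slit_domain :: "complex set" where
  "slit_domain = {z. \<forall>a\<in>R. coord a z \<notin> \<real>\<^sub>\<le>\<^sub>0}"

definition sector :: "complex \<Rightarrow> complex set" where
  "sector a = {z. \<forall>c\<in>R - {a}. 0 < Im ((z - b) / (c - b)) * Im ((a - b) / (c - b))}"

definition root_const :: complex where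
  "root_const = csqrt (\<Prod>c\<in>R. b - c)"

text \<open>D(z) is D(b) times the product of the \<open>coord c z\<close>, and each factor has its
  principal root off its own slit.\<close>

definition slit_root :: "complex \<Rightarrow> complex" where
  "slit_root z = root_const * (\<Prod>c\<in>R. csqrt (coord c z))"

text \<open>A root of D / \<open>coord a\<close>, which stays holomorphic across the slit of
  \<open>a\<close>. Thus sqrt D is y times this function, y being a root of
  \<open>coord a\<close>.\<close>

definition sector_root :: "complex \<Rightarrow> complex \<Rightarrow> complex" where
  "sector_root a z = root_const * (\<Prod>c\<in>R - {a}. csqrt (coord c z))"

definition square_chart :: "complex \<Rightarrow> complex \<Rightarrow> complex" where
  "square_chart a y = a - (a - b) * y\<^sup>2"

definition chart_domain :: "complex \<Rightarrow> complex set" where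
  "chart_domain a = {y. square_chart a y \<in> sector a}"

lemma root_neq_base: "a \<in> R \<Longrightarrow> a \<noteq> b"
proof -
  assume a: "a \<in> R"
  have "R \<noteq> {a}" using card_R by auto
  with a obtain c where "c \<in> R" "c \<noteq> a" by auto
  with generic[of a c] a show "a \<noteq> b" by auto
qed

lemma coord_base [simp]: "coord a b = 1"
  by (simp add: coord_def)

lemma coord_mult: "a \<in> R \<Longrightarrow> (b - a) * coord a z = z - a"
  using root_neq_base[of a] by (simp add: coord_def field_simps)

lemma square_chart_eq_iff: "a \<in> R \<Longrightarrow> square_chart a y = z \<longleftrightarrow> y\<^sup>2 = coord a z"
  using root_neq_base[of a] by (auto simp: coord_def square_chart_def field_simps)

lemma coord_has_field_derivative [derivative_intros]:
  "(coord a has_field_derivative - 1 / (a - b)) (at z within T)"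
  unfolding coord_def by (auto intro!: derivative_eq_intros simp: divide_inverse)

lemma coord_holomorphic [holomorphic_intros]: "coord a holomorphic_on T"
  unfolding coord_def divide_inverse by (intro holomorphic_intros)

lemma coord_convex_combination:
  assumes "u + v = 1"
  shows "coord a (u *\<^sub>R p + v *\<^sub>R q) = u *\<^sub>R coord a p + v *\<^sub>R coord a q"
proof -
  have v: "v = 1 - u" using assms by simp
  show ?thesis unfolding coord_def v by (simp add: scaleR_conv_of_real algebra_simps diff_divide_distrib add_divide_distrib)
qed

lemma sector_coord_nonreal:
  assumes "z \<in> sector a" and "c \<in> R" and "c \<noteq> a"
  shows "coord c z \<notin> \<real>"
  using assms by (force simp: sector_def coord_def complex_is_Real_iff)

lemma sector_slit_domain_iff:
  assumes "a \<in> R" and "z \<in> sector a"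
  shows "z \<in> slit_domain \<longleftrightarrow> coord a z \<notin> \<real>\<^sub>\<le>\<^sub>0"
  using sector_coord_nonreal[OF assms(2)] assms(1)
  by (auto simp: slit_domain_def Nonpos_Reals_iff_real)

lemma sectors_disjoint_off_slit_domain:
  assumes "a \<in> R" and "c \<in> R" and "a \<noteq> c" and "z \<in> sector a" and "z \<in> sector c"
  shows "z \<in> slit_domain"
  using assms sector_coord_nonreal[of z c a] sector_slit_domain_iff[of a z]
  by (auto simp: Nonpos_Reals_iff_real)

lemma ray_in_sector:
  assumes "a \<in> R" and "0 < t"
  shows "b + of_real t * (a - b) \<in> sector a"
  unfolding sector_def mem_Collect_eq
proof
  fix c assume "c \<in> R - {a}"
  then have "Im ((a - b) / (c - b)) \<noteq> 0" using generic assms(1) by blast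
  moreover have "(b + of_real t * (a - b) - b) / (c - b) = of_real t * ((a - b) / (c - b))" by simp
  moreover have "Im (of_real t * w) * Im w = t * (Im w)\<^sup>2" for w
    by (simp add: power2_eq_square)
  ultimately show "0 < Im ((b + of_real t * (a - b) - b) / (c - b)) * Im ((a - b) / (c - b))"
    using assms(2) by (simp only: zero_less_mult_iff zero_less_power2) simp
qed

lemma root_in_sector: "a \<in> R \<Longrightarrow> a \<in> sector a"
  using ray_in_sector[of a 1] by simp

text \<open>The slit domain and the sectors form an open cover of the plane: where
  \<open>coord a z\<close> is 1 - t with t \<ge> 1, the point lies on the ray from \<open>b\<close>
  through \<open>a\<close>.\<close>

lemma slit_domain_or_sector:
  assumes "z \<notin> slit_domain"
  obtains a where "a \<in> R" and "z \<in> sector a" and "coord a z \<in> \<real>\<^sub>\<le>\<^sub>0"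
proof -
  obtain a where a: "a \<in> R" "coord a z \<in> \<real>\<^sub>\<le>\<^sub>0" using assms by (auto simp: slit_domain_def)
  define t where "t = 1 - Re (coord a z)"
  have t: "t > 0" using a(2) by (auto simp: t_def Nonpos_Reals_iff_real)
  have "coord a z = of_real (1 - t)" using a(2) by (auto simp: t_def Nonpos_Reals_iff_real)
  then have "z = b + of_real t * (a - b)"
    using root_neq_base[OF a(1)] by (simp add: coord_def field_simps)
  then show ?thesis using that a ray_in_sector[OF a(1) t] by simp
qed

lemma open_slit_domain: "open slit_domain"
proof -
  have "slit_domain = (\<Inter>a\<in>R. coord a -` (- \<real>\<^sub>\<le>\<^sub>0))" by (auto simp: slit_domain_def)
  moreover have "open (coord a -` (- \<real>\<^sub>\<le>\<^sub>0))" for a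
    by (intro open_vimage open_Compl closed_nonpos_Reals_complex holomorphic_on_imp_continuous_on coord_holomorphic)
  ultimately show ?thesis using finite_R by (auto intro: open_INT)
qed

lemma open_sector: "open (sector a)"
proof -
  have "sector a = (\<Inter>c\<in>R - {a}. {z. 0 < Im ((z - b) / (c - b)) * Im ((a - b) / (c - b))})"
    by (auto simp: sector_def)
  moreover have "open {z. 0 < Im ((z - b) / (c - b)) * Im ((a - b) / (c - b))}" for c
    unfolding divide_inverse by (intro open_Collect_less continuous_intros)
  ultimately show ?thesis using finite_R by (auto intro: open_INT)
qed

lemma convex_sector: "convex (sector a)"
proof (rule convexI)
  fix p q and u v :: real
  assume p: "p \<in> sector a" and q: "q \<in> sector a" and uv: "0 \<le> u" "0 \<le> v" "u + v = 1"
  show "u *\<^sub>R p + v *\<^sub>R q \<in> sector a"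
    unfolding sector_def mem_Collect_eq
  proof
    fix c assume c: "c \<in> R - {a}"
    let ?k = "Im ((a - b) / (c - b))"
    have v: "v = 1 - u" using uv by simp
    have "(u *\<^sub>R p + v *\<^sub>R q - b) = of_real u * (p - b) + of_real v * (q - b)"
      unfolding v by (simp add: scaleR_conv_of_real algebra_simps)
    then have "(u *\<^sub>R p + v *\<^sub>R q - b) / (c - b) = of_real u * ((p - b) / (c - b)) + of_real v * ((q - b) / (c - b))"
      by (simp add: add_divide_distrib)
    then have "Im ((u *\<^sub>R p + v *\<^sub>R q - b) / (c - b)) * ?k
        = u * (Im ((p - b) / (c - b)) * ?k) + v * (Im ((q - b) / (c - b)) * ?k)"
      by (simp only: plus_complex.sel times_complex.sel Re_complex_of_real Im_complex_of_real
          mult_zero_left add_0_right distrib_right mult.assoc)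
    moreover have "0 < Im ((p - b) / (c - b)) * ?k" "0 < Im ((q - b) / (c - b)) * ?k"
      using p q c by (auto simp: sector_def)
    ultimately show "0 < Im ((u *\<^sub>R p + v *\<^sub>R q - b) / (c - b)) * ?k"
      using uv convex_bound_lt[of "- (Im ((p - b) / (c - b)) * ?k)" 0 "- (Im ((q - b) / (c - b)) * ?k)" u v]
      by simp
  qed
qed

lemma starlike_slit_domain: "starlike slit_domain"
  unfolding starlike_def
proof (intro bexI ballI subsetI)
  show "b \<in> slit_domain" by (simp add: slit_domain_def complex_nonpos_Reals_iff)
  fix z y assume z: "z \<in> slit_domain" and "y \<in> closed_segment b z"
  then obtain u v where uv: "0 \<le> u" "0 \<le> v" "u + v = 1" and y: "y = u *\<^sub>R b + v *\<^sub>R z"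
    by (auto simp: closed_segment_def) (metis add.commute diff_add_cancel diff_ge_0_iff_ge)
  show "y \<in> slit_domain"
    unfolding slit_domain_def mem_Collect_eq
  proof (intro ballI notI)
    fix a assume a: "a \<in> R" "coord a y \<in> \<real>\<^sub>\<le>\<^sub>0"
    then have "u *\<^sub>R of_real 1 + v *\<^sub>R coord a z \<in> \<real>\<^sub>\<le>\<^sub>0"
      by (simp add: y coord_convex_combination[OF uv(3)])
    then have "coord a z \<in> \<real>\<^sub>\<le>\<^sub>0" by (rule nonpos_convex_combination[OF _ uv]) simp
    then show False using z a(1) by (simp add: slit_domain_def)
  qed
qed

lemma sector_minus_slit_connected:
  assumes "a \<in> R"
  shows "connected (sector a \<inter> slit_domain)"
proof -
  \<comment> \<open>The midpoint of \<open>b\<close> and \<open>a\<close> lies in the convex sector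
    and has the positive coordinate 1/2, so it is a star centre of the sector minus the
    slit.\<close>
  define m where "m = b + of_real (1/2) * (a - b)"
  have m: "m \<in> sector a" unfolding m_def using assms by (intro ray_in_sector) auto
  have cm: "coord a m = of_real (1/2)" using root_neq_base[OF assms] by (simp add: m_def coord_def)
  have "starlike (sector a \<inter> slit_domain)"
    unfolding starlike_def
  proof (intro bexI ballI subsetI)
    show "m \<in> sector a \<inter> slit_domain"
      using m sector_slit_domain_iff[OF assms m] unfolding cm by (simp add: complex_nonpos_Reals_iff)
    fix z y assume z: "z \<in> sector a \<inter> slit_domain" and "y \<in> closed_segment m z"
    then obtain u v where uv: "0 \<le> u" "0 \<le> v" "u + v = 1" and y: "y = u *\<^sub>R m + v *\<^sub>R z"
      by (auto simp: closed_segment_def) (metis add.commute diff_add_cancel diff_ge_0_iff_ge)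
    have ys: "y \<in> sector a" unfolding y using convexD[OF convex_sector m _ uv] z by simp
    have "coord a y \<notin> \<real>\<^sub>\<le>\<^sub>0"
      unfolding y coord_convex_combination[OF uv(3)] cm
      using nonpos_convex_combination[OF _ uv, of "1/2" "coord a z"] z sector_slit_domain_iff[OF assms, of z] by auto
    then show "y \<in> sector a \<inter> slit_domain" using ys sector_slit_domain_iff[OF assms ys] by simp
  qed
  then show ?thesis by (rule starlike_imp_connected)
qed

lemma root_const_sq: "root_const\<^sup>2 = (\<Prod>c\<in>R. b - c)"
  by (simp add: root_const_def)

lemma slit_root_sq: "(slit_root z)\<^sup>2 = (\<Prod>c\<in>R. z - c)"
proof -
  have "(slit_root z)\<^sup>2 = (\<Prod>c\<in>R. b - c) * (\<Prod>c\<in>R. coord c z)"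
    by (simp add: slit_root_def power_mult_distrib root_const_sq prod_power_distrib)
  also have "\<dots> = (\<Prod>c\<in>R. (b - c) * coord c z)" by (simp add: prod.distrib)
  also have "\<dots> = (\<Prod>c\<in>R. z - c)" by (intro prod.cong) (auto simp: coord_mult)
  finally show ?thesis .
qed

lemma slit_root_eq: "a \<in> R \<Longrightarrow> slit_root z = csqrt (coord a z) * sector_root a z"
  using finite_R by (simp add: slit_root_def sector_root_def prod.remove[of R a])

lemma sector_root_sq:
  assumes "a \<in> R"
  shows "coord a z * (sector_root a z)\<^sup>2 = (\<Prod>c\<in>R. z - c)"
  using slit_root_sq[of z] by (simp add: slit_root_eq[OF assms] power_mult_distrib)

lemma root_const_nonzero: "root_const \<noteq> 0"
  using finite_R root_neq_base by (auto simp: root_const_def)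

lemma slit_root_nonzero: "z \<in> slit_domain \<Longrightarrow> slit_root z \<noteq> 0"
  using finite_R by (force simp: slit_root_def root_const_nonzero slit_domain_def)

lemma sector_root_nonzero: "z \<in> sector a \<Longrightarrow> sector_root a z \<noteq> 0"
  using finite_R sector_coord_nonreal[of z a] by (force simp: sector_root_def root_const_nonzero)

lemma slit_root_holomorphic: "slit_root holomorphic_on slit_domain"
  unfolding slit_root_def by (intro holomorphic_intros) (auto simp: slit_domain_def)

lemma sector_root_holomorphic: "sector_root a holomorphic_on sector a"
  unfolding sector_root_def
  by (intro holomorphic_intros) (use sector_coord_nonreal in \<open>auto simp: Nonpos_Reals_iff_real\<close>)

lemma square_chart_holomorphic: "square_chart a holomorphic_on T"
  unfolding square_chart_def by (intro holomorphic_intros)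

lemma open_chart_domain: "open (chart_domain a)"
proof -
  have "chart_domain a = square_chart a -` sector a" by (auto simp: chart_domain_def)
  then show ?thesis
    by (auto intro!: open_vimage open_sector holomorphic_on_imp_continuous_on square_chart_holomorphic)
qed

lemma zero_in_chart_domain: "a \<in> R \<Longrightarrow> 0 \<in> chart_domain a"
  by (simp add: chart_domain_def square_chart_def root_in_sector)

lemma minus_in_chart_domain: "- y \<in> chart_domain a \<longleftrightarrow> y \<in> chart_domain a"
  by (simp add: chart_domain_def square_chart_def)

lemma chart_domain_segment:
  assumes "a \<in> R" and "y \<in> chart_domain a"
  shows "closed_segment 0 y \<subseteq> chart_domain a"
proof
  fix w assume "w \<in> closed_segment 0 y"
  then obtain t where t: "0 \<le> t" "t \<le> 1" and w: "w = t *\<^sub>R y" by (auto simp: closed_segment_def)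
  \<comment> \<open>The quadratic chart sends the segment from 0 to y onto the segment from
    \<open>a\<close> to \<open>square_chart a y\<close>, which lies in the convex sector.\<close>
  have "square_chart a w = (1 - t\<^sup>2) *\<^sub>R a + t\<^sup>2 *\<^sub>R square_chart a y"
    by (simp add: w square_chart_def scaleR_conv_of_real algebra_simps)
  also have "\<dots> \<in> sector a"
    using assms t by (intro convexD[OF convex_sector] root_in_sector)
      (auto simp: chart_domain_def power_le_one)
  finally show "w \<in> chart_domain a" by (simp add: chart_domain_def)
qed

lemma starlike_chart_domain: "a \<in> R \<Longrightarrow> starlike (chart_domain a)"
  unfolding starlike_def using zero_in_chart_domain chart_domain_segment by blast

lemma chart_domain_iff:
  assumes "a \<in> R" and "y\<^sup>2 = coord a z"
  shows "y \<in> chart_domain a \<longleftrightarrow> z \<in> sector a"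
  using assms square_chart_eq_iff[of a y z] by (simp add: chart_domain_def)

section \<open>Primitives of U / sqrt D on the slit plane and in the square charts\<close>

lemma slit_primitive_exists:
  assumes "U holomorphic_on UNIV"
  obtains \<Phi> where "\<And>z. z \<in> slit_domain \<Longrightarrow> (\<Phi> has_field_derivative U z / slit_root z) (at z)"
proof -
  have "(\<lambda>z. U z / slit_root z) holomorphic_on slit_domain"
    using assms slit_root_nonzero
    by (intro holomorphic_intros slit_root_holomorphic) (auto intro: holomorphic_on_subset)
  then have "\<exists>\<Phi>. \<forall>z\<in>slit_domain. (\<Phi> has_field_derivative U z / slit_root z) (at z)"
    using open_slit_domain
    by (intro holomorphic_starlike_primitive[OF _ starlike_slit_domain _ finite.emptyI])
      (auto intro: holomorphic_on_imp_continuous_on holomorphic_on_imp_differentiable_at)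
  then show ?thesis using that by blast
qed

text \<open>For z = a - (a - b) y^2 one has dz = - 2 (a - b) y dy and sqrt D = y *
  \<open>sector_root\<close>. The factor y cancels, so the integrand is holomorphic at y = 0 and
  even in y; its primitive vanishing at 0 is odd.\<close>

lemma chart_primitive_exists:
  assumes "U holomorphic_on UNIV" and a: "a \<in> R"
  obtains K where "\<And>y. y \<in> chart_domain a \<Longrightarrow>
      (K has_field_derivative - 2 * (a - b) * U (square_chart a y) / sector_root a (square_chart a y)) (at y)"
    and "\<And>y. y \<in> chart_domain a \<Longrightarrow> K (- y) = - K y"
proof -
  define g where "g = (\<lambda>y. - 2 * (a - b) * U (square_chart a y) / sector_root a (square_chart a y))"
  have "(U \<circ> square_chart a) holomorphic_on chart_domain a"
    "(sector_root a \<circ> square_chart a) holomorphic_on chart_domain a"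
    by (rule holomorphic_on_compose_gen[OF square_chart_holomorphic];
        use assms(1) sector_root_holomorphic in \<open>auto simp: chart_domain_def\<close>)+
  then have "g holomorphic_on chart_domain a"
    unfolding g_def o_def by (intro holomorphic_intros) (auto simp: chart_domain_def sector_root_nonzero)
  then have "\<exists>K. \<forall>y\<in>chart_domain a. (K has_field_derivative g y) (at y)"
    using open_chart_domain
    by (intro holomorphic_starlike_primitive[OF _ starlike_chart_domain[OF a] _ finite.emptyI])
      (auto intro: holomorphic_on_imp_continuous_on holomorphic_on_imp_differentiable_at)
  then obtain K0 where K0: "\<And>y. y \<in> chart_domain a \<Longrightarrow> (K0 has_field_derivative g y) (at y)"
    by blast
  define K where "K = (\<lambda>y. K0 y - K0 0)"
  have K: "(K has_field_derivative g y) (at y)" if "y \<in> chart_domain a" for y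
    unfolding K_def using K0[OF that] by (auto intro!: derivative_eq_intros)
  have "\<exists>c. \<forall>y\<in>chart_domain a. K y + K (- y) = c"
  proof (unfold constant_on_def[symmetric], rule has_field_derivative_0_imp_constant_on)
    show "connected (chart_domain a)"
      using starlike_chart_domain[OF a] by (rule starlike_imp_connected)
    show "((\<lambda>y. K y + K (- y)) has_field_derivative 0) (at y)" if "y \<in> chart_domain a" for y
    proof -
      have "(K has_field_derivative g (- y)) (at (- y))" using K minus_in_chart_domain that by blast
      then have "((\<lambda>y. K (- y)) has_field_derivative g (- y) * - 1) (at y)"
        by (rule DERIV_chain2) (auto intro!: derivative_eq_intros)
      moreover have "g (- y) = g y" by (simp add: g_def square_chart_def)
      ultimately show ?thesis using K[OF that] by (auto intro!: derivative_eq_intros)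
    qed
  qed (rule open_chart_domain)
  then obtain c where "\<And>y. y \<in> chart_domain a \<Longrightarrow> K y + K (- y) = c" by blast
  moreover have "K 0 + K (- 0) = 0" by (simp add: K_def)
  ultimately have "K (- y) = - K y" if "y \<in> chart_domain a" for y
    using that zero_in_chart_domain[OF a] by (metis add_eq_0_iff)
  then show ?thesis using that K unfolding g_def by blast
qed

end

text \<open>Oddness forces \<open>K a 0 = 0\<close>, so \<open>e a\<close> is the limit of \<Phi> at
  the root \<open>a\<close>.\<close>

locale slit_primitive = slit_plane +
  fixes U \<Phi> :: "complex \<Rightarrow> complex" and K :: "complex \<Rightarrow> complex \<Rightarrow> complex" and e :: "complex \<Rightarrow> complex"
  assumes \<Phi>_derivative: "\<And>z. z \<in> slit_domain \<Longrightarrow> (\<Phi> has_field_derivative U z / slit_root z) (at z)"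
    and K_derivative: "\<And>a y. a \<in> R \<Longrightarrow> y \<in> chart_domain a \<Longrightarrow>
      (K a has_field_derivative - 2 * (a - b) * U (square_chart a y) / sector_root a (square_chart a y)) (at y)"
    and K_odd: "\<And>a y. a \<in> R \<Longrightarrow> y \<in> chart_domain a \<Longrightarrow> K a (- y) = - K a y"
    and \<Phi>_eq: "\<And>a z. a \<in> R \<Longrightarrow> z \<in> sector a \<Longrightarrow> z \<in> slit_domain \<Longrightarrow> \<Phi> z = e a + K a (csqrt (coord a z))"

lemma (in slit_plane) slit_primitive_locale_exists:
  assumes "U holomorphic_on UNIV" and "a0 \<in> R"
  obtains \<Phi> K e where "slit_primitive R b U \<Phi> K e" and "e a0 = 0"
proof -
  obtain \<Phi> where \<Phi>: "\<And>z. z \<in> slit_domain \<Longrightarrow> (\<Phi> has_field_derivative U z / slit_root z) (at z)"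
    using slit_primitive_exists[OF assms(1)] by blast
  have "\<forall>a\<in>R. \<exists>K. (\<forall>y\<in>chart_domain a. (K has_field_derivative - 2 * (a - b) * U (square_chart a y) / sector_root a (square_chart a y)) (at y))
      \<and> (\<forall>y\<in>chart_domain a. K (- y) = - K y)"
    by (metis chart_primitive_exists[OF assms(1)])
  then obtain K where K: "\<And>a y. a \<in> R \<Longrightarrow> y \<in> chart_domain a \<Longrightarrow>
      (K a has_field_derivative - 2 * (a - b) * U (square_chart a y) / sector_root a (square_chart a y)) (at y)"
    and odd: "\<And>a y. a \<in> R \<Longrightarrow> y \<in> chart_domain a \<Longrightarrow> K a (- y) = - K a y"
    by metis
  \<comment> \<open>Both terms are primitives of the same function on the sector minus its slit,
    which is connected.\<close>
  have "\<exists>c. \<forall>z\<in>sector a \<inter> slit_domain. \<Phi> z - K a (csqrt (coord a z)) = c" if a: "a \<in> R" for a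
  proof (unfold constant_on_def[symmetric], rule has_field_derivative_0_imp_constant_on)
    show "((\<lambda>z. \<Phi> z - K a (csqrt (coord a z))) has_field_derivative 0) (at z)"
      if "z \<in> sector a \<inter> slit_domain" for z
    proof -
      let ?y = "csqrt (coord a z)"
      have y: "?y \<in> chart_domain a" using that chart_domain_iff[OF a, of ?y z] by simp
      have z: "square_chart a ?y = z" using square_chart_eq_iff[OF a] by simp
      have "coord a z \<notin> \<real>\<^sub>\<le>\<^sub>0" using that sector_slit_domain_iff[OF a, of z] by blast
      then have dy: "((\<lambda>z. csqrt (coord a z)) has_field_derivative - 1 / (a - b) / (2 * ?y)) (at z)"
        by (intro derivative_intros)
      have "((\<lambda>z. K a (csqrt (coord a z))) has_field_derivative
          - 2 * (a - b) * U z / sector_root a z * (- 1 / (a - b) / (2 * ?y))) (at z)"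
        using DERIV_chain2[OF K[OF a y] dy] unfolding z by simp
      moreover have "- 2 * (a - b) * U z / sector_root a z * (- 1 / (a - b) / (2 * ?y)) = U z / slit_root z"
      proof -
        have "- 2 * k * u / s * (- 1 / k / (2 * y)) = u / (y * s)" if "k \<noteq> 0" for k u s y :: complex
          using that by (simp add: field_simps)
        from this[of "a - b"] show ?thesis using root_neq_base[OF a] by (simp only: slit_root_eq[OF a]) simp
      qed
      ultimately show ?thesis using \<Phi>[of z] that by (auto intro!: derivative_eq_intros)
    qed
  qed (use a open_sector open_slit_domain in \<open>auto simp: sector_minus_slit_connected\<close>)
  then obtain e where e: "\<And>a z. a \<in> R \<Longrightarrow> z \<in> sector a \<inter> slit_domain \<Longrightarrow> \<Phi> z - K a (csqrt (coord a z)) = e a"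
    by metis
  \<comment> \<open>Normalizes the value at \<open>a0\<close>, the starting point of all the paths,
    to 0.\<close>
  have "slit_primitive R b U (\<lambda>z. \<Phi> z - e a0) K (\<lambda>a. e a - e a0)"
  proof unfold_locales
    show "((\<lambda>z. \<Phi> z - e a0) has_field_derivative U z / slit_root z) (at z)" if "z \<in> slit_domain" for z
      using \<Phi>[OF that] by (auto intro!: derivative_eq_intros)
    show "\<Phi> z - e a0 = e a - e a0 + K a (csqrt (coord a z))" if "a \<in> R" "z \<in> sector a" "z \<in> slit_domain" for a z
      using e[of a z] that by (auto simp: algebra_simps)
  qed (use K odd in auto)
  then show ?thesis using that by (metis diff_self)
qed

section \<open>Integrals along arbitrary paths\<close>

context slit_primitive
begin

text \<open>Turning around \<open>a\<close> and then around \<open>c\<close> shifts \<Phi> by 2 e a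
  - 2 e c. In the application \<open>e\<close> vanishes at one root, so these differences generate
  all of this group.\<close>

definition even_periods :: "complex set" where
  "even_periods = range (\<lambda>m :: complex \<Rightarrow> int. 2 * (\<Sum>c\<in>R. of_int (m c) * e c))"

lemma even_periods_diff:
  assumes "x \<in> even_periods" and "y \<in> even_periods"
  shows "x - y \<in> even_periods"
proof -
  obtain m k :: "complex \<Rightarrow> int" where "x = 2 * (\<Sum>c\<in>R. of_int (m c) * e c)" "y = 2 * (\<Sum>c\<in>R. of_int (k c) * e c)"
    using assms by (auto simp: even_periods_def)
  then have "x - y = 2 * (\<Sum>c\<in>R. of_int (m c - k c) * e c)"
    by (simp add: left_diff_distrib sum_subtractf)
  then show ?thesis unfolding even_periods_def by (rule range_eqI[where x = "\<lambda>c. m c - k c"])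
qed

lemma zero_in_even_periods: "0 \<in> even_periods"
  unfolding even_periods_def by (rule range_eqI[of _ _ "\<lambda>_. 0"]) simp

lemma even_periods_generator: "a \<in> R \<Longrightarrow> 2 * e a \<in> even_periods"
proof -
  assume "a \<in> R"
  then have "(\<Sum>c\<in>R. of_int (if c = a then 1 else 0) * e c) = e a"
    using finite_R by (simp add: if_distrib[of of_int] if_distrib[of "\<lambda>x. x * _"] cong: if_cong)
  then show ?thesis unfolding even_periods_def by (intro range_eqI[of _ _ "\<lambda>c. if c = a then 1 else 0"]) simp
qed

lemma even_periods_cong:
  assumes "x - y \<in> even_periods"
  shows "x \<in> even_periods \<longleftrightarrow> y \<in> even_periods"
  using even_periods_diff[OF _ assms, of x] even_periods_diff[OF zero_in_even_periods assms]
    even_periods_diff[of y "0 - (x - y)"] by auto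

text \<open>
  \<open>value_at z w\<close> is the set of values at the point \<open>(z, w)\<close> of all continuations of the primitive
  along the double cover; it is a coset of \<open>even_periods\<close>, since continuation around a root \<open>a\<close>
  turns \<open>\<Phi>\<close> into \<open>2 * e a - \<Phi>\<close> and \<open>w\<close> into \<open>- w\<close>.
\<close>

definition value_at :: "complex \<Rightarrow> complex \<Rightarrow> complex set" where
  "value_at z w =
     {v. (\<exists>\<sigma>\<in>{1, -1}. z \<in> slit_domain \<and> w = \<sigma> * slit_root z \<and> v - \<sigma> * \<Phi> z \<in> even_periods) \<or>
         (\<exists>a\<in>R. z \<in> sector a \<and> v - e a - K a (w / sector_root a z) \<in> even_periods)}"

text \<open>The chart coordinate of (z, w) is \<sigma> times the principal root, and
  \<open>K a\<close> is odd. The two descriptions therefore differ by (\<sigma> - 1) * e a, which is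
  0 or - 2 * e a; this is where the factor 2 in \<open>even_periods\<close> comes from.\<close>

lemma charts_agree:
  assumes a: "a \<in> R" and z: "z \<in> sector a" "z \<in> slit_domain" and \<sigma>: "\<sigma> \<in> {1, -1}"
    and w: "w = \<sigma> * slit_root z"
  shows "v - e a - K a (w / sector_root a z) \<in> even_periods \<longleftrightarrow> v - \<sigma> * \<Phi> z \<in> even_periods"
proof (rule even_periods_cong)
  let ?y = "csqrt (coord a z)"
  have y: "?y \<in> chart_domain a" using chart_domain_iff[OF a, of ?y z] z by simp
  have "w / sector_root a z = \<sigma> * ?y"
    using sector_root_nonzero[OF z(1)] by (simp add: w slit_root_eq[OF a])
  then have "K a (w / sector_root a z) = \<sigma> * K a ?y"
    using \<sigma> K_odd[OF a y] by auto
  then have "(v - e a - K a (w / sector_root a z)) - (v - \<sigma> * \<Phi> z) = (\<sigma> - 1) * e a"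
    using \<Phi>_eq[OF a z] by (simp add: algebra_simps)
  moreover have "(\<sigma> - 1) * e a \<in> even_periods"
    using \<sigma> zero_in_even_periods even_periods_diff[OF zero_in_even_periods even_periods_generator[OF a]] by auto
  ultimately show "(v - e a - K a (w / sector_root a z)) - (v - \<sigma> * \<Phi> z) \<in> even_periods" by simp
qed

lemma value_at_slit_domain:
  assumes "z \<in> slit_domain" and "\<sigma> \<in> {1, -1}" and "w = \<sigma> * slit_root z"
  shows "v \<in> value_at z w \<longleftrightarrow> v - \<sigma> * \<Phi> z \<in> even_periods"
proof -
  have "\<sigma>' = \<sigma>" if "w = \<sigma>' * slit_root z" for \<sigma>'
    using that assms(3) slit_root_nonzero[OF assms(1)] by simp
  moreover have "v - e a - K a (w / sector_root a z) \<in> even_periods \<longleftrightarrow> v - \<sigma> * \<Phi> z \<in> even_periods"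
    if "a \<in> R" "z \<in> sector a" for a
    using charts_agree[OF that assms] .
  ultimately show ?thesis
    unfolding value_at_def mem_Collect_eq using assms by metis
qed

text \<open>Off the slit domain only one sector contains \<open>z\<close>, so the existential in
  \<open>value_at\<close> has a single possible witness; on the slit domain
  \<open>charts_agree\<close> identifies all descriptions.\<close>

lemma value_at_sector:
  assumes "a \<in> R" and "z \<in> sector a" and "w\<^sup>2 = (\<Prod>c\<in>R. z - c)"
  shows "v \<in> value_at z w \<longleftrightarrow> v - e a - K a (w / sector_root a z) \<in> even_periods"
proof (cases "z \<in> slit_domain")
  case True
  have "w\<^sup>2 = (slit_root z)\<^sup>2" using assms(3) slit_root_sq by simp
  then have "w = slit_root z \<or> w = - slit_root z" by (simp add: power2_eq_iff)
  then obtain \<sigma> where "\<sigma> \<in> {1, -1}" "w = \<sigma> * slit_root z" by force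
  then show ?thesis using value_at_slit_domain[OF True] charts_agree[OF assms(1,2) True] by simp
next
  case False
  then show ?thesis
    unfolding value_at_def mem_Collect_eq
    using assms sectors_disjoint_off_slit_domain[of a _ z] by blast
qed

lemma K_zero: "a \<in> R \<Longrightarrow> K a 0 = 0"
  using K_odd[of a 0] zero_in_chart_domain by simp

lemma value_at_root:
  assumes "a \<in> R"
  shows "v \<in> value_at a 0 \<longleftrightarrow> v - e a \<in> even_periods"
proof -
  have "(\<Prod>c\<in>R. a - c) = 0" using assms finite_R by (intro prod_zero) auto
  then show ?thesis using value_at_sector[OF assms root_in_sector[OF assms], of 0] assms by (simp add: K_zero)
qed

text \<open>A short piece of the path stays in the slit domain with a fixed sign of the root, or in
  one sector. There the running integral and the chart primitive have equal increments, however
  often the piece crosses a slit.\<close>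

lemma path_primitive_locally:
  fixes \<gamma> r :: "real \<Rightarrow> complex"
  defines "f \<equiv> \<lambda>t. U (\<gamma> t) / r t * vector_derivative \<gamma> (at t within {0..1})"
  assumes f: "(f has_integral I) {0..1}"
    and g: "continuous_on {0..1} \<gamma>" and r: "continuous_on {0..1} r"
    and r2: "\<And>t. t \<in> {0..1} \<Longrightarrow> (r t)\<^sup>2 = (\<Prod>c\<in>R. \<gamma> t - c)"
    and k: "finite k" and dg: "\<And>t. t \<in> {0<..<1} - k \<Longrightarrow> \<gamma> differentiable (at t)"
    and avoids: "\<And>t. t \<in> {0<..<1} \<Longrightarrow> \<gamma> t \<notin> R"
    and t0: "t0 \<in> {0..1}"
  shows "\<exists>\<delta>>0. \<forall>u\<in>{0..1} \<inter> ball t0 \<delta>. \<forall>v\<in>{0..1} \<inter> ball t0 \<delta>.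
           integral {0..u} f \<in> value_at (\<gamma> u) (r u) \<longrightarrow> integral {0..v} f \<in> value_at (\<gamma> v) (r v)"
proof -
  have dg': "(\<gamma> has_vector_derivative vector_derivative \<gamma> (at t within {0..1})) (at t)"
    if "t \<in> {0<..<1} - k" for t
  proof -
    have d: "(\<gamma> has_vector_derivative vector_derivative \<gamma> (at t)) (at t)"
      using dg[OF that] by (simp add: vector_derivative_works)
    then have "vector_derivative \<gamma> (at t within {0..1}) = vector_derivative \<gamma> (at t)"
      using that by (intro vector_derivative_at_within_ivl) auto
    then show ?thesis using d by simp
  qed
  have r0: "r t \<noteq> 0" if "t \<in> {0<..<1}" for t
    using r2[of t] avoids[OF that] that finite_R by force
  \<comment> \<open>The order of \<open>u\<close> and \<open>v\<close> is left open, because the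
    induction over the interval needs the transfer both ways.\<close>
  have step: "integral {0..v} f - integral {0..u} f = \<psi> v - \<psi> u"
    if T: "T \<subseteq> {0..1}" "is_interval T" "continuous_on T \<psi>"
      and d: "\<And>t. t \<in> T \<Longrightarrow> t \<in> {0<..<1} - k \<Longrightarrow> (\<psi> has_vector_derivative f t) (at t)"
      and uv: "u \<in> T" "v \<in> T"
    for T \<psi> u v
  proof -
    have le: "integral {0..v} f - integral {0..u} f = \<psi> v - \<psi> u" if "u \<in> T" "v \<in> T" "u \<le> v" for u v
    proof (rule integrand_antiderivative[OF f _ that(3) k])
      have sub: "{u..v} \<subseteq> T" using that T(2) unfolding is_interval_1 by (meson atLeastAtMost_iff subsetI)
      then show "{u..v} \<subseteq> {0..1}" using T(1) by blast
      show "continuous_on {u..v} \<psi>" using T(3) sub continuous_on_subset by blast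
      fix t assume t: "t \<in> {u<..<v} - k"
      then have "t \<in> {0<..<1} - k" using \<open>{u..v} \<subseteq> {0..1}\<close> that(3) by force
      then show "(\<psi> has_vector_derivative f t) (at t)" using d sub t
        by (meson DiffD1 greaterThanLessThan_subseteq_atLeastAtMost_iff order_refl subset_iff)
    qed
    show ?thesis
    proof (cases "u \<le> v")
      case True
      then show ?thesis using le uv by blast
    next
      case False
      then have "integral {0..u} f - integral {0..v} f = \<psi> u - \<psi> v" using le uv by simp
      then show ?thesis by (simp add: algebra_simps)
    qed
  qed
  have near: "\<exists>\<delta>>0. \<forall>t\<in>{0..1} \<inter> ball t0 \<delta>. \<gamma> t \<in> T" if T: "open T" "\<gamma> t0 \<in> T" for T
  proof -
    obtain \<epsilon> where "\<epsilon> > 0" "ball (\<gamma> t0) \<epsilon> \<subseteq> T" by (rule openE[OF T])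
    moreover obtain \<delta> where "\<delta> > 0" "\<forall>t\<in>{0..1}. dist t t0 < \<delta> \<longrightarrow> dist (\<gamma> t) (\<gamma> t0) < \<epsilon>"
      using g[unfolded continuous_on_iff, rule_format, OF t0 \<open>\<epsilon> > 0\<close>] by blast
    ultimately show ?thesis by (intro exI[of _ \<delta>]) (auto simp: dist_commute subset_iff)
  qed
  have ivl: "is_interval ({0..1} \<inter> ball t0 \<delta>)" for \<delta>
    by (intro is_interval_Int) (simp_all add: is_interval_convex_1 convex_ball)
  show ?thesis
  proof (cases "\<gamma> t0 \<in> slit_domain")
    case True
    have "(r t0)\<^sup>2 = (slit_root (\<gamma> t0))\<^sup>2" using r2[OF t0] slit_root_sq by simp
    then have "r t0 = slit_root (\<gamma> t0) \<or> r t0 = - slit_root (\<gamma> t0)" by (simp add: power2_eq_iff)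
    then obtain \<sigma> where \<sigma>: "\<sigma> \<in> {1, -1 :: complex}" "r t0 = \<sigma> * slit_root (\<gamma> t0)" by force
    obtain \<delta>1 where \<delta>1: "\<delta>1 > 0" "\<forall>t\<in>{0..1} \<inter> ball t0 \<delta>1. \<gamma> t \<in> slit_domain"
      using near[OF open_slit_domain True] by blast
    \<comment> \<open>This continuous quotient takes only the values 1 and -1. They are at distance
      2, so staying closer than 2 to the value at \<open>t0\<close> fixes the sign.\<close>
    define q where "q = (\<lambda>t. r t / slit_root (\<gamma> t))"
    have sr: "continuous_on ({0..1} \<inter> ball t0 \<delta>1) (\<lambda>t. slit_root (\<gamma> t))"
      using \<delta>1(2) by (intro continuous_on_compose2[OF holomorphic_on_imp_continuous_on[OF slit_root_holomorphic]]
          continuous_on_subset[OF g]) auto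
    have qc: "continuous_on ({0..1} \<inter> ball t0 \<delta>1) q"
      unfolding q_def using \<delta>1(2) slit_root_nonzero
      by (intro continuous_on_divide sr continuous_on_subset[OF r]) auto
    have t0': "t0 \<in> {0..1} \<inter> ball t0 \<delta>1" using t0 \<delta>1(1) by simp
    have q0: "q t0 = \<sigma>" using \<sigma>(2) slit_root_nonzero[OF True] by (simp add: q_def)
    obtain \<delta>2 where \<delta>2: "\<delta>2 > 0" "\<forall>t\<in>{0..1} \<inter> ball t0 \<delta>1. dist t t0 < \<delta>2 \<longrightarrow> dist (q t) (q t0) < 2"
      using qc[unfolded continuous_on_iff, rule_format, OF t0' zero_less_numeral] by blast
    define \<delta> where "\<delta> = min \<delta>1 \<delta>2"
    let ?T = "{0..1} \<inter> ball t0 \<delta>"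
    have T: "\<gamma> t \<in> slit_domain" "r t = \<sigma> * slit_root (\<gamma> t)" if "t \<in> ?T" for t
    proof -
      show d: "\<gamma> t \<in> slit_domain" using that \<delta>1(2) by (auto simp: \<delta>_def)
      have "(r t)\<^sup>2 = (slit_root (\<gamma> t))\<^sup>2" using that r2 slit_root_sq by simp
      then have "r t = slit_root (\<gamma> t) \<or> r t = - slit_root (\<gamma> t)" by (simp add: power2_eq_iff)
      then have "q t = 1 \<or> q t = -1" using slit_root_nonzero[OF d] by (auto simp: q_def)
      moreover have "dist (q t) \<sigma> < 2" using that \<delta>2(2) q0 by (auto simp: \<delta>_def dist_commute)
      ultimately have "q t = \<sigma>" using \<sigma>(1) by (auto simp: dist_norm)
      then show "r t = \<sigma> * slit_root (\<gamma> t)" using slit_root_nonzero[OF d] by (auto simp: q_def)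
    qed
    have "integral {0..u} f \<in> value_at (\<gamma> u) (r u) \<longrightarrow> integral {0..v} f \<in> value_at (\<gamma> v) (r v)"
      if uv: "u \<in> ?T" "v \<in> ?T" for u v
    proof -
      have "integral {0..v} f - integral {0..u} f = \<sigma> * \<Phi> (\<gamma> v) - \<sigma> * \<Phi> (\<gamma> u)"
      proof (rule step[where T = ?T])
        have "continuous_on slit_domain \<Phi>"
          using \<Phi>_derivative by (meson DERIV_isCont continuous_at_imp_continuous_on)
        moreover have "\<gamma> ` ?T \<subseteq> slit_domain" using T(1) by blast
        ultimately have "continuous_on ?T (\<lambda>t. \<Phi> (\<gamma> t))"
          by (rule continuous_on_compose2[OF _ continuous_on_subset[OF g Int_lower1]])
        then show "continuous_on ?T (\<lambda>t. \<sigma> * \<Phi> (\<gamma> t))" by (intro continuous_intros)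
        fix t assume t: "t \<in> ?T" "t \<in> {0<..<1} - k"
        have "((\<Phi> \<circ> \<gamma>) has_vector_derivative
            vector_derivative \<gamma> (at t within {0..1}) * (U (\<gamma> t) / slit_root (\<gamma> t))) (at t)"
          using field_vector_diff_chain_at[OF dg'[OF t(2)] \<Phi>_derivative[OF T(1)[OF t(1)]]] .
        then have "((\<lambda>t. \<sigma> * \<Phi> (\<gamma> t)) has_vector_derivative
            \<sigma> * (vector_derivative \<gamma> (at t within {0..1}) * (U (\<gamma> t) / slit_root (\<gamma> t)))) (at t)"
          unfolding o_def by (rule has_vector_derivative_mult_right)
        moreover have "\<sigma> * (vector_derivative \<gamma> (at t within {0..1}) * (U (\<gamma> t) / slit_root (\<gamma> t))) = f t"
          using \<sigma>(1) T(2)[OF t(1)] by (auto simp: f_def)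
        ultimately show "((\<lambda>t. \<sigma> * \<Phi> (\<gamma> t)) has_vector_derivative f t) (at t)" by simp
      qed (use uv ivl in auto)
      then have "integral {0..v} f - \<sigma> * \<Phi> (\<gamma> v) = integral {0..u} f - \<sigma> * \<Phi> (\<gamma> u)"
        by (simp add: algebra_simps)
      then show ?thesis
        using value_at_slit_domain[OF T(1)[OF uv(1)] \<sigma>(1) T(2)[OF uv(1)]]
          value_at_slit_domain[OF T(1)[OF uv(2)] \<sigma>(1) T(2)[OF uv(2)]] by simp
    qed
    moreover have "\<delta> > 0" using \<delta>1 \<delta>2 by (simp add: \<delta>_def)
    ultimately show ?thesis by blast
  next
    case False
    then obtain a where a: "a \<in> R" "\<gamma> t0 \<in> sector a" using slit_domain_or_sector by blast
    obtain \<delta> where \<delta>: "\<delta> > 0" "\<forall>t\<in>{0..1} \<inter> ball t0 \<delta>. \<gamma> t \<in> sector a"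
      using near[OF open_sector a(2)] by blast
    let ?T = "{0..1} \<inter> ball t0 \<delta>"
    \<comment> \<open>The lift of the path to the chart of \<open>a\<close>. It remains continuous
      when the path begins or ends at \<open>a\<close>; it is differentiable at interior parameters
      off \<open>k\<close>, where it is nonzero.\<close>
    define y where "y = (\<lambda>t. r t / sector_root a (\<gamma> t))"
    have y2: "(y t)\<^sup>2 = coord a (\<gamma> t)" if "t \<in> ?T" for t
      using r2[of t] sector_root_sq[OF a(1), of "\<gamma> t"] sector_root_nonzero[of "\<gamma> t" a] \<delta>(2) that
      by (auto simp: y_def power_divide field_simps)
    have yc: "continuous_on ?T y"
      unfolding y_def using \<delta>(2) sector_root_nonzero
      by (intro continuous_on_divide continuous_on_subset[OF r]
          continuous_on_compose2[OF holomorphic_on_imp_continuous_on[OF sector_root_holomorphic] continuous_on_subset[OF g]]) auto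
    have ychart: "y t \<in> chart_domain a" if "t \<in> ?T" for t
      using chart_domain_iff[OF a(1) y2[OF that]] \<delta>(2) that by blast
    have "integral {0..u} f \<in> value_at (\<gamma> u) (r u) \<longrightarrow> integral {0..v} f \<in> value_at (\<gamma> v) (r v)"
      if uv: "u \<in> ?T" "v \<in> ?T" for u v
    proof -
      have "integral {0..v} f - integral {0..u} f = K a (y v) - K a (y u)"
      proof (rule step[where T = ?T])
        have "continuous_on (chart_domain a) (K a)"
          using K_derivative[OF a(1)] by (meson DERIV_isCont continuous_at_imp_continuous_on)
        moreover have "y ` ?T \<subseteq> chart_domain a" using ychart by blast
        ultimately show "continuous_on ?T (\<lambda>t. K a (y t))"
          by (rule continuous_on_compose2[OF _ yc])
        fix t assume t: "t \<in> ?T" "t \<in> {0<..<1} - k"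
        let ?g' = "vector_derivative \<gamma> (at t within {0..1})"
        have T_t: "at t within ?T = at t" using t \<delta>(1)
          by (intro at_within_open_subset[of _ "{0<..<1} \<inter> ball t0 \<delta>"]) auto
        have sec: "\<gamma> t \<in> sector a" using \<delta>(2) t(1) by blast
        have y0: "y t \<noteq> 0" using r0[of t] t sector_root_nonzero[OF sec] by (simp add: y_def)
        have "((coord a \<circ> \<gamma>) has_vector_derivative ?g' * (- 1 / (a - b))) (at t within ?T)"
          unfolding T_t by (rule field_vector_diff_chain_at[OF dg'[OF t(2)]]) (rule coord_has_field_derivative)
        then have dc: "((\<lambda>t. coord a (\<gamma> t)) has_derivative (\<lambda>h. h *\<^sub>R (?g' * (- 1 / (a - b))))) (at t within ?T)"
          by (simp only: has_vector_derivative_def o_def)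
        have "(y has_derivative (\<lambda>h. h *\<^sub>R (?g' * (- 1 / (a - b))) / (2 * y t))) (at t within ?T)"
          by (rule has_derivative_sqrt_branch[OF _ t(1) y0 y2 dc])
            (use yc t(1) in \<open>auto simp: continuous_on_eq_continuous_within\<close>)
        then have "(y has_vector_derivative ?g' * (- 1 / (a - b)) / (2 * y t)) (at t)"
          unfolding T_t has_vector_derivative_def by (simp only: scaleR_conv_of_real times_divide_eq_right)
        moreover have "(K a has_field_derivative
            - 2 * (a - b) * U (\<gamma> t) / sector_root a (\<gamma> t)) (at (y t))"
          using K_derivative[OF a(1) ychart[OF t(1)]] y2[OF t(1)] square_chart_eq_iff[OF a(1), of "y t" "\<gamma> t"] by simp
        ultimately have "((K a \<circ> y) has_vector_derivative
            ?g' * (- 1 / (a - b)) / (2 * y t) * (- 2 * (a - b) * U (\<gamma> t) / sector_root a (\<gamma> t))) (at t)"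
          by (rule field_vector_diff_chain_at)
        moreover have "?g' * (- 1 / (a - b)) / (2 * y t) * (- 2 * (a - b) * U (\<gamma> t) / sector_root a (\<gamma> t)) = f t"
        proof -
          have "g' * (- 1 / d) / (2 * y) * (- 2 * d * u / s) = u / (y * s) * g'" if "d \<noteq> 0"
            for g' d y u s :: complex
            using that by (simp add: field_simps)
          then have "?g' * (- 1 / (a - b)) / (2 * y t) * (- 2 * (a - b) * U (\<gamma> t) / sector_root a (\<gamma> t))
              = U (\<gamma> t) / (y t * sector_root a (\<gamma> t)) * ?g'"
            using root_neq_base[OF a(1)] right_minus_eq by blast
          moreover have "y t * sector_root a (\<gamma> t) = r t"
            using sector_root_nonzero[OF sec] by (simp add: y_def)
          ultimately show ?thesis by (simp only: f_def)
        qed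
        ultimately show "((\<lambda>t. K a (y t)) has_vector_derivative f t) (at t)" by (simp only: o_def)
      qed (use uv ivl in auto)
      then have eq: "integral {0..v} f - e a - K a (y v) = integral {0..u} f - e a - K a (y u)"
        by (simp add: algebra_simps)
      have mem: "x \<in> value_at (\<gamma> t) (r t) \<longleftrightarrow> x - e a - K a (y t) \<in> even_periods" if "t \<in> ?T" for x t
        unfolding y_def using that \<delta>(2) r2 by (intro value_at_sector a(1)) auto
      show ?thesis unfolding mem[OF uv(1)] mem[OF uv(2)] eq by (rule imp_refl)
    qed
    with \<delta>(1) show ?thesis by blast
  qed
qed

text \<open>The running integral starts with the value 0 = e a0 at the root \<open>a0\<close>.
  Membership in \<open>value_at\<close> then spreads over the connected interval, and at the root
  \<open>a\<close> it is a statement about \<open>e a\<close> modulo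
  \<open>even_periods\<close>.\<close>

lemma path_integral_value:
  fixes \<gamma> r :: "real \<Rightarrow> complex"
  assumes "has_integral_U_over_sqrt U r I \<gamma>" and "valid_path \<gamma>"
    and "pathstart \<gamma> = a0" and "a0 \<in> R" and "e a0 = 0" and "pathfinish \<gamma> = a" and "a \<in> R"
    and "\<And>t. t \<in> {0<..<1} \<Longrightarrow> \<gamma> t \<notin> R" and "continuous_on {0..1} r"
    and r2: "\<And>t. t \<in> {0..1} \<Longrightarrow> (r t)\<^sup>2 = (\<Prod>c\<in>R. \<gamma> t - c)"
  shows "I - e a \<in> even_periods"
proof -
  define f where "f = (\<lambda>t. U (\<gamma> t) / r t * vector_derivative \<gamma> (at t within {0..1}))"
  have f: "(f has_integral I) {0..1}" using assms(1) by (simp add: has_integral_U_over_sqrt_def f_def)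
  obtain k where k: "finite k" "\<gamma> C1_differentiable_on {0..1} - k" "continuous_on {0..1} \<gamma>"
    using assms(2) unfolding valid_path_def piecewise_C1_differentiable_on_def by auto
  have end_zero: "r t = 0" if "t \<in> {0..1}" "\<gamma> t \<in> R" for t
  proof -
    have "(\<Prod>c\<in>R. \<gamma> t - c) = 0" using that(2) finite_R by (intro prod_zero) auto
    then show ?thesis using r2[OF that(1)] by simp
  qed
  have "integral {0..1} f \<in> value_at (\<gamma> 1) (r 1)"
  proof (rule connected_induction_simple[where S = "{0..1}" and a = 0
        and P = "\<lambda>t. integral {0..t} f \<in> value_at (\<gamma> t) (r t)"])
    show "integral {0..0} f \<in> value_at (\<gamma> 0) (r 0)"
      using assms(3-5) end_zero[of 0] value_at_root[OF assms(4), of 0] zero_in_even_periods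
      by (simp add: pathstart_def)
    fix t0 :: real assume t0: "t0 \<in> {0..1}"
    have "\<exists>\<delta>>0. \<forall>u\<in>{0..1} \<inter> ball t0 \<delta>. \<forall>v\<in>{0..1} \<inter> ball t0 \<delta>.
           integral {0..u} f \<in> value_at (\<gamma> u) (r u) \<longrightarrow> integral {0..v} f \<in> value_at (\<gamma> v) (r v)"
      unfolding f_def
      by (rule path_primitive_locally[OF f[unfolded f_def] k(3) assms(9) r2 k(1) _ assms(8) t0])
        (use k(2) in \<open>auto simp: C1_differentiable_on_eq\<close>)
    then obtain \<delta> where "\<delta> > 0" "\<forall>u\<in>{0..1} \<inter> ball t0 \<delta>. \<forall>v\<in>{0..1} \<inter> ball t0 \<delta>.
           integral {0..u} f \<in> value_at (\<gamma> u) (r u) \<longrightarrow> integral {0..v} f \<in> value_at (\<gamma> v) (r v)"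
      by blast
    then show "\<exists>T. openin (top_of_set {0..1}) T \<and> t0 \<in> T \<and> (\<forall>x\<in>T. \<forall>y\<in>T.
        integral {0..x} f \<in> value_at (\<gamma> x) (r x) \<longrightarrow> integral {0..y} f \<in> value_at (\<gamma> y) (r y))"
      using t0 by (intro exI[of _ "{0..1} \<inter> ball t0 \<delta>"]) (auto simp: openin_open_Int)
  qed auto
  moreover have "\<gamma> 1 = a" "r 1 = 0" using assms(6,7) end_zero[of 1] by (auto simp: pathfinish_def)
  moreover have "integral {0..1} f = I" using f by (rule integral_unique)
  ultimately show ?thesis using value_at_root[OF assms(7)] by simp
qed

end

text \<open>The coefficient matrix is the identity modulo 2, hence invertible over the rationals.\<close>

lemma odd_system_rational:
  fixes x :: "'a \<Rightarrow> complex" and B :: "'a \<Rightarrow> 'a \<Rightarrow> int"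
  assumes "finite A" and "\<And>a c. a \<in> A \<Longrightarrow> c \<in> A \<Longrightarrow> even (B a c) \<longleftrightarrow> a \<noteq> c"
    and "\<And>a. a \<in> A \<Longrightarrow> (\<Sum>c\<in>A. of_int (B a c) * x c) \<in> \<rat>" and "a \<in> A"
  shows "x a \<in> \<rat>"
  using assms
proof (induction A arbitrary: B a rule: finite_induct)
  case (insert u A)
  \<comment> \<open>Elimination of \<open>u\<close> without division. As \<open>B u u\<close> is odd
    and \<open>B a u\<close> even for a \<noteq> u, the new matrix has the same parity
    pattern.\<close>
  define B' where "B' = (\<lambda>a c. B u u * B a c - B a u * B u c)"
  have rat_u: "of_int (B u u) * x u + (\<Sum>c\<in>A. of_int (B u c) * x c) \<in> \<rat>"
    using insert.prems(2)[of u] insert.hyps by simp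
  have A: "x a \<in> \<rat>" if "a \<in> A" for a
  proof (rule insert.IH[of B'])
    show "even (B' a c) \<longleftrightarrow> a \<noteq> c" if "a \<in> A" "c \<in> A" for a c
      using insert.prems(1)[of u u] insert.prems(1)[of a c] insert.prems(1)[of a u] insert.prems(1)[of u c]
        that insert.hyps(2) by (auto simp: B'_def)
    fix a assume a: "a \<in> A"
    have "of_int (B a u) * x u + (\<Sum>c\<in>A. of_int (B a c) * x c) \<in> \<rat>"
      using insert.prems(2)[of a] insert.hyps a by simp
    then have "of_int (B u u) * (of_int (B a u) * x u + (\<Sum>c\<in>A. of_int (B a c) * x c))
        - of_int (B a u) * (of_int (B u u) * x u + (\<Sum>c\<in>A. of_int (B u c) * x c)) \<in> \<rat>"
      using rat_u by (intro Rats_diff Rats_mult Rats_of_int)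
    also have "of_int (B u u) * (of_int (B a u) * x u + (\<Sum>c\<in>A. of_int (B a c) * x c))
        - of_int (B a u) * (of_int (B u u) * x u + (\<Sum>c\<in>A. of_int (B u c) * x c))
      = (\<Sum>c\<in>A. of_int (B' a c) * x c)"
      by (simp add: B'_def algebra_simps sum_subtractf sum_distrib_left)
    finally show "(\<Sum>c\<in>A. of_int (B' a c) * x c) \<in> \<rat>" .
  qed (use that in auto)
  have "x u \<in> \<rat>"
  proof -
    have "(\<Sum>c\<in>A. of_int (B u c) * x c) \<in> \<rat>" using A by (intro Rats_sum Rats_mult Rats_of_int)
    with rat_u have "of_int (B u u) * x u \<in> \<rat>" by (metis Rats_diff add_diff_cancel_right')
    then have "of_int (B u u) * x u / of_int (B u u) \<in> \<rat>" by (intro Rats_divide Rats_of_int)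
    moreover have "B u u \<noteq> 0" using insert.prems(1)[of u u] by auto
    ultimately show ?thesis by simp
  qed
  with A insert.prems(3) show ?case by auto
qed simp

lemma common_denominator:
  fixes x :: "'a \<Rightarrow> complex"
  assumes "finite A" and "\<And>a. a \<in> A \<Longrightarrow> x a \<in> \<rat>"
  obtains N :: nat where "N > 0" and "\<And>a. a \<in> A \<Longrightarrow> of_nat N * x a \<in> \<int>"
proof -
  have "\<exists>N::nat. N > 0 \<and> (\<forall>a\<in>A. of_nat N * x a \<in> \<int>)"
    using assms
  proof (induction A rule: finite_induct)
    case (insert u A)
    then obtain N :: nat where N: "N > 0" "\<forall>a\<in>A. of_nat N * x a \<in> \<int>" by auto
    have "x u \<in> \<rat>" using insert.prems by simp
    then obtain i j :: int where ij: "j > 0" "x u = of_int i / of_int j" by (auto elim: Rats_cases')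
    have "of_nat (N * nat j) * x a \<in> \<int>" if "a \<in> insert u A" for a
    proof (cases "a = u")
      case True
      have "of_nat (N * nat j) * x u = of_int (int N * i)" using ij by simp
      then show ?thesis using True by (simp only: Ints_of_int)
    next
      case False
      then have "of_nat N * x a \<in> \<int>" using N(2) that by blast
      moreover have "of_nat (N * nat j) * x a = of_nat (nat j) * (of_nat N * x a)" by simp
      ultimately show ?thesis by (simp only: Ints_mult Ints_of_nat)
    qed
    then show ?case using N(1) ij(1) by (intro exI[of _ "N * nat j"]) auto
  qed (intro exI[of _ 1], simp)
  then show ?thesis using that by blast
qed

text \<open>After division by pi \<i> the integral to each root is an integer that equals
  \<open>x a\<close> plus an even integer combination of all \<open>x c\<close>.\<close>

lemma (in slit_primitive) periods_commensurable:
  assumes a0: "a0 \<in> R" "e a0 = 0"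
    and "\<And>a. a \<in> R \<Longrightarrow> a \<noteq> a0 \<Longrightarrow> \<exists>m::int. of_int m * (of_real pi * \<i>) - e a \<in> even_periods"
  obtains N :: nat where "N > 0" and "\<And>a. a \<in> R \<Longrightarrow> \<exists>m::int. of_nat N * e a = of_int m * (of_real pi * \<i>)"
proof -
  define x where "x = (\<lambda>a. e a / (of_real pi * \<i>))"
  have ex: "e a = x a * (of_real pi * \<i>)" for a by (simp add: x_def)
  have "\<exists>k :: complex \<Rightarrow> int. x a + 2 * (\<Sum>c\<in>R. of_int (k c) * x c) \<in> \<rat>" if "a \<in> R" for a
  proof (cases "a = a0")
    case True
    \<comment> \<open>No path leads to the base root; its row is the relation
      \<open>x a0 = 0\<close>.\<close>
    then show ?thesis using a0 by (intro exI[of _ "\<lambda>_. 0"]) (simp add: x_def)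
  next
    case False
    then obtain m :: int and k :: "complex \<Rightarrow> int"
      where "of_int m * (of_real pi * \<i>) - e a = 2 * (\<Sum>c\<in>R. of_int (k c) * e c)"
      using assms(3)[OF \<open>a \<in> R\<close>] by (auto simp: even_periods_def)
    moreover have "(\<Sum>c\<in>R. of_int (k c) * e c) = (\<Sum>c\<in>R. of_int (k c) * x c) * (of_real pi * \<i>)"
      by (simp add: ex sum_distrib_right mult.assoc)
    ultimately have "of_int m * (of_real pi * \<i>) = (x a + 2 * (\<Sum>c\<in>R. of_int (k c) * x c)) * (of_real pi * \<i>)"
      by (simp add: ex[of a] algebra_simps)
    then have "x a + 2 * (\<Sum>c\<in>R. of_int (k c) * x c) = of_int m" by simp
    then show ?thesis by (metis Rats_of_int)
  qed
  then obtain k :: "complex \<Rightarrow> complex \<Rightarrow> int" where k: "\<And>a. a \<in> R \<Longrightarrow> x a + 2 * (\<Sum>c\<in>R. of_int (k a c) * x c) \<in> \<rat>"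
    by metis
  define B where "B = (\<lambda>a c. (if a = c then 1 else 0) + 2 * k a c)"
  have "x a \<in> \<rat>" if "a \<in> R" for a
  proof (rule odd_system_rational[OF finite_R _ _ that])
    show "even (B a c) \<longleftrightarrow> a \<noteq> c" for a c by (simp add: B_def)
    fix a assume a: "a \<in> R"
    have "(\<Sum>c\<in>R. of_int (B a c) * x c) = (\<Sum>c\<in>R. (if a = c then x c else 0) + 2 * (of_int (k a c) * x c))"
      by (intro sum.cong) (auto simp: B_def algebra_simps)
    also have "\<dots> = x a + 2 * (\<Sum>c\<in>R. of_int (k a c) * x c)"
      using finite_R a by (simp add: sum.distrib sum_distrib_left)
    finally show "(\<Sum>c\<in>R. of_int (B a c) * x c) \<in> \<rat>" using k[OF a] by simp
  qed
  then obtain N :: nat where "N > 0" and N: "\<And>a. a \<in> R \<Longrightarrow> of_nat N * x a \<in> \<int>"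
    using common_denominator[OF finite_R] by blast
  moreover have "\<exists>m::int. of_nat N * e a = of_int m * (of_real pi * \<i>)" if "a \<in> R" for a
    using N[OF that] by (auto simp: ex Ints_def simp flip: mult.assoc)
  ultimately show ?thesis using that by blast
qed

section \<open>Entire functions from the primitive\<close>

lemma holomorphic_on_cosh_comp:
  fixes f :: "complex \<Rightarrow> complex"
  assumes "f holomorphic_on A"
  shows "(\<lambda>z. cosh (f z)) holomorphic_on A"
  unfolding cosh_field_def using assms by (intro holomorphic_intros) auto

lemma holomorphic_on_sinh_comp:
  fixes f :: "complex \<Rightarrow> complex"
  assumes "f holomorphic_on A"
  shows "(\<lambda>z. sinh (f z)) holomorphic_on A"
  unfolding sinh_field_def using assms by (intro holomorphic_intros) auto

lemma cmod_cosh_le: "cmod (cosh z) \<le> exp \<bar>Re z\<bar>"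
proof -
  have "cmod (exp z + exp (- z)) \<le> exp (Re z) + exp (- Re z)"
    using norm_triangle_ineq[of "exp z" "exp (- z)"] by simp
  also have "\<dots> \<le> exp \<bar>Re z\<bar> + exp \<bar>Re z\<bar>" by (intro add_mono) auto
  finally show ?thesis by (simp add: cosh_field_def norm_divide)
qed

lemma sinh_eq_0_imp_Re: "sinh (z :: complex) = 0 \<Longrightarrow> Re z = 0"
proof -
  assume "sinh z = 0"
  then have "exp z = 1 \<or> exp z = -1" by (simp add: sinh_zero_iff)
  then have "cmod (exp z) = 1" by (metis norm_minus_cancel norm_one)
  then show ?thesis by simp
qed

text \<open>Evenness hides the choice of root: off the cut \<open>csqrt\<close> is holomorphic, on
  the negative axis \<i> * csqrt (- x) replaces it, and at 0 continuity makes the singularity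
  removable.\<close>

lemma even_csqrt_holomorphic:
  assumes "open X" and E: "E holomorphic_on {y. y\<^sup>2 \<in> X}"
    and even: "\<And>y. y\<^sup>2 \<in> X \<Longrightarrow> E (- y) = E y"
  shows "(\<lambda>x. E (csqrt x)) holomorphic_on X"
proof (rule no_isolated_singularity'[where K = "X \<inter> {0}"])
  let ?Q = "{y::complex. y\<^sup>2 \<in> X}"
  have "open ((\<lambda>y::complex. y\<^sup>2) -` X)" using assms(1) by (intro open_vimage continuous_intros)
  then have oQ: "open ?Q" by (simp add: vimage_def)
  show "((\<lambda>x. E (csqrt x)) \<longlongrightarrow> E (csqrt z)) (at z within X)" if z: "z \<in> X \<inter> {0}" for z
  proof -
    have "0 \<in> ?Q" using z by auto
    then have "isCont E 0"
      using holomorphic_on_imp_continuous_on[OF E] oQ continuous_on_eq_continuous_at by blast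
    moreover have "(csqrt \<longlongrightarrow> 0) (at 0)"
    proof (rule tendsto_norm_zero_cancel)
      have "isCont (\<lambda>x. sqrt (cmod x)) 0" by (intro continuous_intros)
      then show "((\<lambda>x. cmod (csqrt x)) \<longlongrightarrow> 0) (at 0)" by (simp add: isCont_def)
    qed
    ultimately have "((\<lambda>x. E (csqrt x)) \<longlongrightarrow> E 0) (at 0)" by (rule isCont_tendsto_compose)
    then show ?thesis using z by (auto intro: tendsto_within_subset)
  qed
  have "X - X \<inter> {0} = X - {0}" by blast
  moreover have "(\<lambda>x. E (csqrt x)) holomorphic_on X - {0}"
    unfolding holomorphic_on_def
  proof
    fix x assume x: "x \<in> X - {0}"
    show "(\<lambda>x. E (csqrt x)) field_differentiable at x within X - {0}"
    proof (cases "x \<in> \<real>\<^sub>\<le>\<^sub>0")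
      case False
      have "(E \<circ> csqrt) holomorphic_on X \<inter> (- \<real>\<^sub>\<le>\<^sub>0)"
        by (rule holomorphic_on_compose_gen[OF _ E]) (auto intro!: holomorphic_intros)
      then have "(\<lambda>x. E (csqrt x)) field_differentiable at x"
        using x False assms(1) unfolding o_def
        by (intro holomorphic_on_imp_differentiable_at[where s = "X \<inter> (- \<real>\<^sub>\<le>\<^sub>0)"]) (auto intro!: open_Int open_Compl closed_nonpos_Reals_complex)
      then show ?thesis by (rule field_differentiable_at_within)
    next
      case True
      have mx: "- x \<notin> \<real>\<^sub>\<le>\<^sub>0" using x True by (auto simp: complex_nonpos_Reals_iff complex_eq_iff)
      have "E (csqrt y) = E (\<i> * csqrt (- y))" if "y \<in> X" for y
      proof -
        have "(csqrt y)\<^sup>2 = (\<i> * csqrt (- y))\<^sup>2" by (simp add: power_mult_distrib)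
        then have "\<i> * csqrt (- y) = csqrt y \<or> \<i> * csqrt (- y) = - csqrt y"
          by (metis power2_eq_iff)
        then show ?thesis using even[of "csqrt y"] that by auto
      qed
      moreover have "(E \<circ> (\<lambda>y. \<i> * csqrt (- y))) holomorphic_on X \<inter> {y. - y \<notin> \<real>\<^sub>\<le>\<^sub>0}"
        by (rule holomorphic_on_compose_gen[OF _ E]) (auto intro!: holomorphic_intros simp: power_mult_distrib)
      ultimately have "(\<lambda>x. E (csqrt x)) holomorphic_on X \<inter> {y. - y \<notin> \<real>\<^sub>\<le>\<^sub>0}"
        unfolding o_def by (subst holomorphic_cong[OF refl]) auto
      moreover have "open {y :: complex. - y \<notin> \<real>\<^sub>\<le>\<^sub>0}"
      proof -
        have "open (uminus -` (- \<real>\<^sub>\<le>\<^sub>0 :: complex set))"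
          by (intro open_vimage open_Compl closed_nonpos_Reals_complex continuous_intros)
        moreover have "{y :: complex. - y \<notin> \<real>\<^sub>\<le>\<^sub>0} = uminus -` (- \<real>\<^sub>\<le>\<^sub>0)" by auto
        ultimately show ?thesis by simp
      qed
      ultimately have "(\<lambda>x. E (csqrt x)) field_differentiable at x"
        using x mx assms(1) by (intro holomorphic_on_imp_differentiable_at[where s = "X \<inter> {y. - y \<notin> \<real>\<^sub>\<le>\<^sub>0}"]) auto
      then show ?thesis by (rule field_differentiable_at_within)
    qed
  qed
  ultimately show "(\<lambda>x. E (csqrt x)) holomorphic_on X - X \<inter> {0}" by simp
qed (use assms(1) in auto)

lemma entire_polynomial_growth:
  assumes "f holomorphic_on UNIV" and "\<And>z. A \<le> cmod z \<Longrightarrow> cmod (f z) \<le> B * cmod z ^ k"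
  obtains p where "f = poly p"
proof
  show "f = poly (\<Sum>j\<le>k. monom ((deriv ^^ j) f 0 / fact j) j)"
    using Liouville_polynomial[OF assms] by (simp add: fun_eq_iff poly_sum poly_monom)
qed

section \<open>Gluing across the slits\<close>

context slit_plane
begin

lemma even_chart_holomorphic:
  assumes "a \<in> R" and "E holomorphic_on chart_domain a"
    and "\<And>y. y \<in> chart_domain a \<Longrightarrow> E (- y) = E y"
  shows "(\<lambda>z. E (csqrt (coord a z))) holomorphic_on sector a"
proof -
  define X where "X = {x. a - (a - b) * x \<in> sector a}"
  have Q: "chart_domain a = {y. y\<^sup>2 \<in> X}" by (simp add: chart_domain_def square_chart_def X_def)
  have "open ((\<lambda>x. a - (a - b) * x) -` sector a)"
    by (intro open_vimage open_sector continuous_intros)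
  then have "open X" by (simp add: vimage_def X_def)
  then have "(\<lambda>x. E (csqrt x)) holomorphic_on X"
    using assms(2,3) unfolding Q by (intro even_csqrt_holomorphic) auto
  moreover have "a - (a - b) * coord a z = z" for z
    using root_neq_base[OF assms(1)] by (simp add: coord_def field_simps)
  then have "coord a ` sector a \<subseteq> X" by (auto simp: X_def)
  ultimately have "((\<lambda>x. E (csqrt x)) \<circ> coord a) holomorphic_on sector a"
    by (intro holomorphic_on_compose_gen[OF coord_holomorphic])
  then show ?thesis by (simp add: o_def)
qed

text \<open>Distinct sectors meet only inside the slit domain, so at a point of a slit the choice of
  sector is forced and the local functions fit together.\<close>

lemma glue_entire:
  assumes "f holomorphic_on slit_domain" and g: "\<And>a. a \<in> R \<Longrightarrow> g a holomorphic_on sector a"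
    and agree: "\<And>a z. a \<in> R \<Longrightarrow> z \<in> sector a \<Longrightarrow> z \<in> slit_domain \<Longrightarrow> f z = g a z"
  obtains F where "F holomorphic_on UNIV" and "\<And>z. z \<in> slit_domain \<Longrightarrow> F z = f z"
proof
  define F where "F = (\<lambda>z. if z \<in> slit_domain then f z else g (SOME a. a \<in> R \<and> z \<in> sector a) z)"
  show eq: "F z = f z" if "z \<in> slit_domain" for z using that by (simp add: F_def)
  have F_sector: "F z = g a z" if "a \<in> R" "z \<in> sector a" for a z
  proof (cases "z \<in> slit_domain")
    case True
    then show ?thesis using eq agree that by simp
  next
    case False
    have "(SOME a. a \<in> R \<and> z \<in> sector a) = a"
      using that False sectors_disjoint_off_slit_domain[of _ a z] by (intro some_equality) auto
    then show ?thesis using False by (simp add: F_def)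
  qed
  have "F holomorphic_on slit_domain" using assms(1) eq by (subst holomorphic_cong[OF refl]) auto
  moreover have "F holomorphic_on sector a" if "a \<in> R" for a
    using g[OF that] F_sector[OF that] by (subst holomorphic_cong[OF refl]) auto
  ultimately have "F field_differentiable at z" for z
    using slit_domain_or_sector[of z] open_slit_domain open_sector
    by (metis holomorphic_on_imp_differentiable_at)
  then show "F holomorphic_on UNIV" by (simp add: holomorphic_on_def)
qed

lemma closure_slit_domain: "closure slit_domain = UNIV"
proof -
  have "z \<in> closure slit_domain" for z
  proof (cases "z \<in> slit_domain")
    case True
    then show ?thesis using closure_subset by blast
  next
    case False
    then obtain a where a: "a \<in> R" "z \<in> sector a" "coord a z \<in> \<real>\<^sub>\<le>\<^sub>0"
      using slit_domain_or_sector by blast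
    obtain \<epsilon> where \<epsilon>: "\<epsilon> > 0" "ball z \<epsilon> \<subseteq> sector a" using open_sector a(2) by (rule openE)
    show ?thesis
      unfolding closure_approachable
    proof (intro allI impI)
      fix \<delta> :: real assume "\<delta> > 0"
      define \<eta> where "\<eta> = min \<delta> \<epsilon> / (2 * cmod (a - b))"
      have ab: "cmod (a - b) > 0" using root_neq_base[OF a(1)] by simp
      have \<eta>: "\<eta> > 0" using ab \<epsilon> \<open>\<delta> > 0\<close> by (simp add: \<eta>_def)
      \<comment> \<open>A step perpendicular to the slit, which gives \<open>coord a\<close> the
        imaginary part \<eta>. Its length is half of \<open>min \<delta> \<epsilon>\<close>, so the
        sector is not left.\<close>
      define y where "y = z - (a - b) * (\<i> * of_real \<eta>)"
      have "dist y z = cmod (a - b) * \<eta>" using \<eta> by (simp add: y_def dist_norm norm_mult)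
      also have "\<dots> = min \<delta> \<epsilon> / 2" using ab by (simp add: \<eta>_def)
      also have "\<dots> < min \<delta> \<epsilon>" using \<epsilon>(1) \<open>\<delta> > 0\<close> by linarith
      finally have dist: "dist y z < \<delta>" "dist y z < \<epsilon>" by auto
      then have ys: "y \<in> sector a" using \<epsilon>(2) by (auto simp: dist_commute)
      have "coord a y = coord a z + \<i> * of_real \<eta>"
        using ab by (simp add: coord_def y_def field_simps)
      then have "Im (coord a y) = \<eta>" using a(3) by (simp add: complex_nonpos_Reals_iff)
      then have "y \<in> slit_domain"
        using sector_slit_domain_iff[OF a(1) ys] \<eta> by (auto simp: complex_nonpos_Reals_iff)
      then show "\<exists>y\<in>slit_domain. dist y z < \<delta>" using dist(1) by blast
    qed
  qed
  then show ?thesis by blast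
qed

lemma slit_domain_unbounded: "\<exists>z\<in>slit_domain. A \<le> cmod z"
proof -
  have "of_real (\<bar>A\<bar> + 1) \<in> closure slit_domain" by (simp add: closure_slit_domain)
  then obtain z where z: "z \<in> slit_domain" "dist z (of_real (\<bar>A\<bar> + 1)) < 1"
    unfolding closure_approachable by (meson zero_less_one)
  have "cmod (of_real (\<bar>A\<bar> + 1)) - cmod z \<le> dist z (of_real (\<bar>A\<bar> + 1))"
    by (metis dist_norm norm_minus_commute norm_triangle_ineq2)
  then have "A \<le> cmod z" using z(2) by simp
  with z(1) show ?thesis by blast
qed

end

context slit_primitive
begin

lemma \<Phi>_holomorphic: "\<Phi> holomorphic_on slit_domain"
  using \<Phi>_derivative open_slit_domain by (auto simp: holomorphic_on_open)

lemma K_holomorphic: "a \<in> R \<Longrightarrow> K a holomorphic_on chart_domain a"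
  using K_derivative open_chart_domain by (auto simp: holomorphic_on_open)

text \<open>Since sinh (N e a) = 0, the addition formulas turn cosh (N \<Phi>) and sinh (N \<Phi>)
  into constant multiples of cosh (N K) and sinh (N K), even and odd in y. Dividing the odd one by
  sqrt D, that is by y * \<open>sector_root\<close>, makes it even as well.\<close>

lemma cosh_sinh_extend:
  fixes N :: nat
  assumes "\<And>a. a \<in> R \<Longrightarrow> \<exists>m::int. of_nat N * e a = of_int m * (of_real pi * \<i>)"
  obtains P Q where "P holomorphic_on UNIV" and "Q holomorphic_on UNIV"
    and "\<And>z. z \<in> slit_domain \<Longrightarrow> P z = cosh (of_nat N * \<Phi> z)"
    and "\<And>z. z \<in> slit_domain \<Longrightarrow> Q z = sinh (of_nat N * \<Phi> z) / slit_root z"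
proof -
  have sinh_e: "sinh (of_nat N * e a) = 0" if a: "a \<in> R" for a
  proof -
    obtain m :: int where m: "of_nat N * e a = of_int m * (of_real pi * \<i>)" using assms[OF a] by blast
    have "(exp (of_nat N * e a))\<^sup>2 = exp ((2 * of_int m * pi) * \<i>)"
      unfolding m by (simp add: power2_eq_square mult_ac flip: exp_add)
    also have "\<dots> = 1" by (rule exp_integer_2pi) simp
    finally show ?thesis by (simp add: sinh_zero_iff power2_eq_1_iff)
  qed
  have cosh_eq: "cosh (of_nat N * \<Phi> z) = cosh (of_nat N * e a) * cosh (of_nat N * K a (csqrt (coord a z)))"
    and sinh_eq: "sinh (of_nat N * \<Phi> z) = cosh (of_nat N * e a) * sinh (of_nat N * K a (csqrt (coord a z)))"
    if "a \<in> R" "z \<in> sector a" "z \<in> slit_domain" for a z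
    unfolding \<Phi>_eq[OF that] distrib_left by (simp_all add: cosh_add sinh_add sinh_e[OF that(1)])
  have P1: "(\<lambda>z. cosh (of_nat N * \<Phi> z)) holomorphic_on slit_domain"
    by (intro holomorphic_on_cosh_comp holomorphic_intros \<Phi>_holomorphic)
  have P2: "(\<lambda>z. cosh (of_nat N * e a) * cosh (of_nat N * K a (csqrt (coord a z)))) holomorphic_on sector a"
    if a: "a \<in> R" for a
    using K_odd[OF a] by (intro holomorphic_on_mult holomorphic_on_const even_chart_holomorphic[OF a]
        holomorphic_on_cosh_comp K_holomorphic[OF a]) simp
  obtain P where P: "P holomorphic_on UNIV" "\<And>z. z \<in> slit_domain \<Longrightarrow> P z = cosh (of_nat N * \<Phi> z)"
    by (rule glue_entire[OF P1 P2 cosh_eq]) simp_all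
  \<comment> \<open>The value at 0 fills the removable singularity of sinh (N K) / y; the numerator
    vanishes there because \<open>K a 0 = 0\<close>.\<close>
  define H where "H = (\<lambda>a y. if y = 0 then deriv (\<lambda>y. sinh (of_nat N * K a y)) 0 else sinh (of_nat N * K a y) / y)"
  have H: "H a holomorphic_on chart_domain a" "\<And>y. y \<in> chart_domain a \<Longrightarrow> H a (- y) = H a y"
    if a: "a \<in> R" for a
  proof -
    have "(\<lambda>y. sinh (of_nat N * K a y)) holomorphic_on chart_domain a"
      by (intro holomorphic_on_sinh_comp holomorphic_on_mult holomorphic_on_const K_holomorphic[OF a])
    from pole_lemma_open[OF this open_chart_domain, of 0] show "H a holomorphic_on chart_domain a"
      by (simp add: H_def K_zero[OF a] cong: if_cong)
    show "H a (- y) = H a y" if "y \<in> chart_domain a" for y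
      using K_odd[OF a that] by (simp add: H_def)
  qed
  have Q1: "(\<lambda>z. sinh (of_nat N * \<Phi> z) / slit_root z) holomorphic_on slit_domain"
    by (intro holomorphic_on_divide slit_root_nonzero slit_root_holomorphic
        holomorphic_on_sinh_comp holomorphic_on_mult holomorphic_on_const \<Phi>_holomorphic)
  have Q2: "(\<lambda>z. cosh (of_nat N * e a) * H a (csqrt (coord a z)) / sector_root a z) holomorphic_on sector a"
    if a: "a \<in> R" for a
    by (intro holomorphic_on_divide sector_root_nonzero sector_root_holomorphic
        holomorphic_on_mult holomorphic_on_const even_chart_holomorphic[OF a] H[OF a])
  have Q3: "sinh (of_nat N * \<Phi> z) / slit_root z = cosh (of_nat N * e a) * H a (csqrt (coord a z)) / sector_root a z"
    if "a \<in> R" "z \<in> sector a" "z \<in> slit_domain" for a z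
    using slit_root_nonzero[OF that(3)] slit_root_eq[OF that(1)]
    by (simp add: sinh_eq[OF that] H_def)
  obtain Q where "Q holomorphic_on UNIV" "\<And>z. z \<in> slit_domain \<Longrightarrow> Q z = sinh (of_nat N * \<Phi> z) / slit_root z"
    by (rule glue_entire[OF Q1 Q2 Q3]) simp_all
  with P show ?thesis using that by blast
qed

section \<open>From entire functions to a polynomial Pell solution\<close>

lemma pellian_if_periods:
  fixes N :: nat and \<alpha> A C :: real
  assumes "N > 0" and periods: "\<And>a. a \<in> R \<Longrightarrow> \<exists>m::int. of_nat N * e a = of_int m * (of_real pi * \<i>)"
    and growth: "\<And>z. z \<in> slit_domain \<Longrightarrow> A \<le> cmod z \<Longrightarrow> \<bar>Re (\<Phi> z)\<bar> \<le> \<alpha> * ln (cmod z) + C"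
    and nonconst: "\<exists>z\<in>slit_domain. Re (\<Phi> z) \<noteq> 0"
  shows "pellian (\<Prod>a\<in>R. [:- a, 1:])"
proof -
  let ?D = "\<Prod>a\<in>R. [:- a, 1:]"
  obtain P Q where P: "P holomorphic_on UNIV" "\<And>z. z \<in> slit_domain \<Longrightarrow> P z = cosh (of_nat N * \<Phi> z)"
    and Q: "Q holomorphic_on UNIV" "\<And>z. z \<in> slit_domain \<Longrightarrow> Q z = sinh (of_nat N * \<Phi> z) / slit_root z"
    using cosh_sinh_extend[OF periods] by metis
  have polyD: "poly ?D z = (slit_root z)\<^sup>2" for z by (simp add: poly_prod slit_root_sq)
  have cont: "continuous_on S P" "continuous_on S Q" for S
    using P(1) Q(1) by (meson holomorphic_on_imp_continuous_on continuous_on_subset subset_UNIV)+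
  \<comment> \<open>The hyperbolic Pythagoras identity on the slit domain, carried to the slits by
    density.\<close>
  have pell: "(P z)\<^sup>2 - (Q z)\<^sup>2 * poly ?D z = 1" for z
  proof (rule continuous_constant_on_closure[where S = slit_domain and f = "\<lambda>z. (P z)\<^sup>2 - (Q z)\<^sup>2 * poly ?D z"])
    show "(P z)\<^sup>2 - (Q z)\<^sup>2 * poly ?D z = 1" if "z \<in> slit_domain" for z
      using slit_root_nonzero[OF that] hyperbolic_pythagoras[of "of_nat N * \<Phi> z"]
      by (simp add: P(2)[OF that] Q(2)[OF that] polyD power_divide)
  qed (auto simp: closure_slit_domain intro!: continuous_intros cont)
  \<comment> \<open>By |cosh w| <= exp |Re w| the growth bound gives exp (N |C|) |z|^(N |\<alpha>|)
    for |z| \<ge> 1; \<open>k\<close> rounds the exponent up.\<close>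
  define k where "k = nat \<lceil>real N * \<bar>\<alpha>\<bar>\<rceil>"
  define B where "B = exp (real N * \<bar>C\<bar>)"
  have bound_slit: "cmod (P z) \<le> B * cmod z ^ k" if z: "z \<in> slit_domain" "max 1 A \<le> cmod z" for z
  proof -
    have pos: "cmod z > 0" using z(2) by linarith
    have "\<bar>Re (\<Phi> z)\<bar> \<le> \<bar>\<alpha>\<bar> * ln (cmod z) + \<bar>C\<bar>"
      using growth[OF z(1)] z(2) by (smt (verit) ln_ge_zero max.bounded_iff mult_right_mono)
    then have "real N * \<bar>Re (\<Phi> z)\<bar> \<le> real N * (\<bar>\<alpha>\<bar> * ln (cmod z) + \<bar>C\<bar>)" by (rule mult_left_mono) simp
    also have "\<dots> = real N * \<bar>\<alpha>\<bar> * ln (cmod z) + real N * \<bar>C\<bar>" by (simp add: algebra_simps)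
    also have "\<dots> \<le> real k * ln (cmod z) + real N * \<bar>C\<bar>"
      using z(2) by (intro add_right_mono mult_right_mono) (auto simp: k_def intro: real_nat_ceiling_ge)
    finally have "\<bar>Re (of_nat N * \<Phi> z)\<bar> \<le> real k * ln (cmod z) + real N * \<bar>C\<bar>" by (simp add: abs_mult)
    then have "exp \<bar>Re (of_nat N * \<Phi> z)\<bar> \<le> exp (real k * ln (cmod z) + real N * \<bar>C\<bar>)" by simp
    also have "\<dots> = B * cmod z ^ k"
      using pos by (simp add: exp_add B_def exp_of_nat_mult)
    finally show ?thesis using cmod_cosh_le[of "of_nat N * \<Phi> z"] by (simp add: P(2)[OF z(1)])
  qed
  have bound_P: "cmod (P z) \<le> B * cmod z ^ k" if z: "max 1 A + 1 \<le> cmod z" for z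
  proof -
    \<comment> \<open>An open neighbourhood of \<open>z\<close> inside the region of the bound; the
      dense slit domain meets it near \<open>z\<close>, so the bound passes to points on the
      slits.\<close>
    let ?O = "{z. max 1 A < cmod z}"
    have "open ?O" by (intro open_Collect_less continuous_intros)
    then have "z \<in> closure (?O \<inter> slit_domain)"
      using open_Int_closure_subset[of ?O slit_domain] z by (auto simp: closure_slit_domain)
    then have "cmod (P z) - B * cmod z ^ k \<le> 0"
      by (rule continuous_le_on_closure[rotated]) (use bound_slit in \<open>auto intro!: continuous_intros cont\<close>)
    then show ?thesis by simp
  qed
  then obtain p where p: "P = poly p" using entire_polynomial_growth[OF P(1)] by blast
  have "filterlim (poly ?D) at_infinity at_infinity"
    using finite_R card_R by (intro filterlim_poly_at_infinity) (subst degree_prod_eq_sum_degree; simp)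
  then have "\<forall>\<^sub>F z in at_infinity. 1 \<le> cmod (poly ?D z)"
    by (auto simp: filterlim_at_infinity[of 0])
  then obtain A' where A': "\<And>z. A' \<le> cmod z \<Longrightarrow> 1 \<le> cmod (poly ?D z)"
    unfolding eventually_at_infinity by blast
  \<comment> \<open>The Pell identity bounds \<open>Q\<close> through \<open>P\<close>: |Q|^2 |D| <=
    (|P| + 1)^2, and |D| \<ge> 1 far out.\<close>
  have bound_Q: "cmod (Q z) \<le> (B + 1) * cmod z ^ k" if z: "max (max 1 A + 1) A' \<le> cmod z" for z
  proof -
    have "1 \<le> cmod z" using z by linarith
    then have z1: "1 \<le> cmod z ^ k" by (rule one_le_power)
    have "(Q z)\<^sup>2 * poly ?D z = (P z)\<^sup>2 - 1" using pell[of z] by (simp add: algebra_simps)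
    then have "(cmod (Q z))\<^sup>2 * cmod (poly ?D z) = cmod ((P z)\<^sup>2 - 1)"
      by (metis norm_mult norm_power)
    also have "\<dots> \<le> (cmod (P z))\<^sup>2 + 1"
      using norm_triangle_ineq4[of "(P z)\<^sup>2" 1] by (simp add: norm_power)
    also have "\<dots> \<le> (cmod (P z) + 1)\<^sup>2" by (simp add: power2_sum)
    finally have "(cmod (Q z))\<^sup>2 * cmod (poly ?D z) \<le> (cmod (P z) + 1)\<^sup>2" .
    moreover have "(cmod (Q z))\<^sup>2 * 1 \<le> (cmod (Q z))\<^sup>2 * cmod (poly ?D z)"
      using A'[of z] z by (intro mult_left_mono) auto
    ultimately have "(cmod (Q z))\<^sup>2 \<le> (cmod (P z) + 1)\<^sup>2" by linarith
    then have "cmod (Q z) \<le> cmod (P z) + 1" by (rule power2_le_imp_le) simp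
    also have "\<dots> \<le> B * cmod z ^ k + cmod z ^ k" using bound_P[of z] z z1 by (intro add_mono) auto
    finally show ?thesis by (simp add: algebra_simps)
  qed
  then obtain q where q: "Q = poly q" using entire_polynomial_growth[OF Q(1)] by blast
  \<comment> \<open>Otherwise sinh (N \<Phi>) vanishes on the slit domain, which makes \<Phi> purely
    imaginary there.\<close>
  have "q \<noteq> 0"
  proof
    assume "q = 0"
    obtain z where z: "z \<in> slit_domain" "Re (\<Phi> z) \<noteq> 0" using nonconst by blast
    have "Q z = 0" by (simp add: q \<open>q = 0\<close>)
    then have "sinh (of_nat N * \<Phi> z) = 0" using Q(2)[OF z(1)] slit_root_nonzero[OF z(1)] by simp
    from sinh_eq_0_imp_Re[OF this] show False using z(2) \<open>N > 0\<close> by simp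
  qed
  moreover have "p\<^sup>2 - q\<^sup>2 * ?D = 1"
  proof -
    have "poly (p\<^sup>2 - q\<^sup>2 * ?D) = poly 1" using pell unfolding p q by (simp add: fun_eq_iff)
    then show ?thesis by (simp only: poly_eq_poly_eq_iff)
  qed
  ultimately show ?thesis unfolding pellian_def by blast
qed

text \<open>On the slit domain Re \<Phi> and c G have the same differential, hence differ by a
  constant. The logarithmic behaviour of G at infinity supplies both the growth bound and a point
  with Re \<Phi> \<noteq> 0.\<close>

lemma pellian_if_is_U:
  fixes N :: nat
  defines "D \<equiv> \<Prod>a\<in>R. [:- a, 1:]"
  assumes U: "is_U D U" and even: "even (card R)" and "N > 0"
    and periods: "\<And>a. a \<in> R \<Longrightarrow> \<exists>m::int. of_nat N * e a = of_int m * (of_real pi * \<i>)"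
  shows "pellian D"
proof -
  obtain V G c where c: "c \<noteq> 0" "U = (\<lambda>z. of_real c * V z)" and G: "is_G D G"
    and dG: "\<And>T s z. sqrt_branch D T s \<Longrightarrow> z \<in> T \<Longrightarrow>
      ((\<lambda>\<zeta>. G \<zeta> (s \<zeta>)) has_derivative (\<lambda>h. Re (V z * h / s z))) (at z)"
    using U unfolding is_U_def is_U_D_def by blast
  have polyD: "poly D z = (slit_root z)\<^sup>2" for z by (simp add: D_def poly_prod slit_root_sq)
  have branch: "sqrt_branch D slit_domain slit_root"
    unfolding sqrt_branch_def
    using open_slit_domain slit_root_nonzero slit_root_holomorphic
    by (auto simp: polyD intro: holomorphic_on_imp_continuous_on)
  define g where "g = (\<lambda>z. G z (slit_root z))"
  have "((\<lambda>z. Re (\<Phi> z) - c * g z) has_derivative (\<lambda>h. 0)) (at z)" if z: "z \<in> slit_domain" for z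
  proof -
    have "(\<Phi> has_derivative (*) (U z / slit_root z)) (at z)"
      using \<Phi>_derivative[OF z] by (simp add: has_field_derivative_def)
    then have "((\<lambda>z. Re (\<Phi> z) - c * g z) has_derivative
        (\<lambda>h. Re (U z / slit_root z * h) - c * Re (V z * h / slit_root z))) (at z)"
      unfolding g_def
      by (intro has_derivative_diff has_derivative_mult_right dG[OF branch z] has_derivative_Re)
    moreover have "Re (U z / slit_root z * h) - c * Re (V z * h / slit_root z) = 0" for h
    proof -
      have eq: "U z / slit_root z * h = of_real c * (V z * h / slit_root z)" by (simp add: c(2))
      have "Re (of_real c * w) = c * Re w" for w by simp
      then show ?thesis unfolding eq by (simp only: right_minus_eq)
    qed
    ultimately show ?thesis by simp
  qed
  then have const: "Re (\<Phi> z) - c * g z = Re (\<Phi> w) - c * g w" if "z \<in> slit_domain" "w \<in> slit_domain" for z w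
    using that starlike_imp_connected[OF starlike_slit_domain] open_slit_domain
    by (intro has_derivative_zero_unique_connected[of slit_domain "\<lambda>z. Re (\<Phi> z) - c * g z"]) auto
  obtain C where C: "\<And>z. z \<in> slit_domain \<Longrightarrow> Re (\<Phi> z) = c * g z + C"
    using slit_domain_unbounded[of 0] const by (metis add.commute diff_add_cancel)
  obtain l where l: "((\<lambda>z. G z (sqrt_at_infinity D z) - ln (cmod z)) \<longlongrightarrow> l) at_infinity"
    using G unfolding is_G_def by blast
  have odd: "line_bundle_section D G" using G unfolding is_G_def Z2_harmonic_def by blast
  from tendstoD[OF l, of 1] have "\<forall>\<^sub>F z in at_infinity. dist (G z (sqrt_at_infinity D z) - ln (cmod z)) l < 1" by simp
  then obtain A where A: "\<And>z. A \<le> cmod z \<Longrightarrow> dist (G z (sqrt_at_infinity D z) - ln (cmod z)) l < 1"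
    unfolding eventually_at_infinity by blast
  have degD: "degree D = card R" unfolding D_def by (subst degree_prod_eq_sum_degree) auto
  \<comment> \<open>\<open>slit_root\<close> need not be the branch that fixes the trivialization at
    infinity: the two agree only up to a sign that may depend on \<open>z\<close>. Absolute values
    absorb this sign, as G is odd.\<close>
  have abs_g: "\<bar>\<bar>g z\<bar> - ln (cmod z)\<bar> \<le> \<bar>l\<bar> + 1" if z: "z \<in> slit_domain" "max 1 A \<le> cmod z" for z
  proof -
    have z0: "z \<noteq> 0" using z(2) by auto
    have "(sqrt_at_infinity D z)\<^sup>2 = z ^ (2 * (degree D div 2)) * (poly D z / z ^ degree D)"
      by (simp add: sqrt_at_infinity_def power_mult_distrib mult.commute flip: power_mult)
    then have "(sqrt_at_infinity D z)\<^sup>2 = (slit_root z)\<^sup>2" using z0 even degD by (simp add: polyD)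
    then have "sqrt_at_infinity D z = slit_root z \<or> sqrt_at_infinity D z = - slit_root z"
      by (simp add: power2_eq_iff)
    moreover have "G z (- slit_root z) = - G z (slit_root z)"
      using odd slit_root_nonzero[OF z(1)] unfolding line_bundle_section_def by (simp add: polyD)
    ultimately have "\<bar>G z (sqrt_at_infinity D z)\<bar> = \<bar>g z\<bar>" by (auto simp: g_def)
    moreover have "0 \<le> ln (cmod z)" using z(2) by (intro ln_ge_zero) simp
    moreover have "dist (G z (sqrt_at_infinity D z) - ln (cmod z)) l < 1" using A z(2) by simp
    ultimately show ?thesis unfolding dist_real_def by (smt (verit))
  qed
  show ?thesis
    unfolding D_def
  proof (rule pellian_if_periods[OF \<open>N > 0\<close> periods])
    fix z assume z: "z \<in> slit_domain" "max 1 A \<le> cmod z"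
    have "\<bar>Re (\<Phi> z)\<bar> \<le> \<bar>c\<bar> * \<bar>g z\<bar> + \<bar>C\<bar>"
      using C[OF z(1)] abs_triangle_ineq[of "c * g z" C] by (simp add: abs_mult)
    also have "\<dots> \<le> \<bar>c\<bar> * (ln (cmod z) + (\<bar>l\<bar> + 1)) + \<bar>C\<bar>"
      using abs_g[OF z] by (intro add_right_mono mult_left_mono) auto
    finally show "\<bar>Re (\<Phi> z)\<bar> \<le> \<bar>c\<bar> * ln (cmod z) + (\<bar>c\<bar> * (\<bar>l\<bar> + 1) + \<bar>C\<bar>)"
      by (simp add: algebra_simps)
  next
    show "\<exists>z\<in>slit_domain. Re (\<Phi> z) \<noteq> 0"
    proof -
      \<comment> \<open>Chosen so that |g z| \<ge> M - |l| - 1 exceeds |C / c|, which keeps c * g z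
        + C away from 0.\<close>
      define M where "M = \<bar>C / c\<bar> + \<bar>l\<bar> + 2"
      obtain z where z: "z \<in> slit_domain" "max (exp M) (max 1 A) \<le> cmod z"
        using slit_domain_unbounded by blast
      have "M \<le> ln (cmod z)" using z(2) by (subst ln_ge_iff) auto
      moreover have "\<bar>\<bar>g z\<bar> - ln (cmod z)\<bar> \<le> \<bar>l\<bar> + 1" using abs_g[OF z(1)] z(2) by simp
      ultimately have "\<bar>g z\<bar> > \<bar>C / c\<bar>" by (auto simp: M_def)
      then have "g z \<noteq> - (C / c)" by auto
      then have "c * g z + C \<noteq> 0" using c(1) by (auto simp: field_simps)
      then show ?thesis using z(1) C by auto
    qed
  qed
qed

end

section \<open>Factorization of D and the equivalence\<close>

text \<open>The orders of the roots sum to the degree, which is the number of roots; each order is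
  at least 1, so each equals 1.\<close>

lemma monic_simple_roots_factorization:
  fixes D :: "complex poly"
  assumes "lead_coeff D = 1" and "degree D = card {z. poly D z = 0}"
  shows "D = (\<Prod>a | poly D a = 0. [:- a, 1:])"
proof -
  have D0: "D \<noteq> 0" using assms(1) by auto
  let ?R = "{z. poly D z = 0}"
  have fin: "finite ?R" using D0 by (rule poly_roots_finite)
  have D: "(\<Prod>a\<in>?R. [:- a, 1:] ^ order a D) = D"
    using complex_poly_decompose[of D] assms(1) by simp
  have "degree D = (\<Sum>a\<in>?R. order a D)"
    by (subst D[symmetric], subst degree_prod_eq_sum_degree) (auto simp: degree_linear_power)
  then have "(\<Sum>a\<in>?R. order a D) = (\<Sum>a\<in>?R. 1)" using assms(2) by simp
  moreover have "1 \<le> order a D" if "a \<in> ?R" for a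
    using that D0 order_root[of D a] by simp
  ultimately have "order a D = 1" if "a \<in> ?R" for a
    using that fin sum_mono_inv[of "\<lambda>_. 1" ?R "\<lambda>a. order a D" a] by simp
  then have "(\<Prod>a\<in>?R. [:- a, 1:] ^ order a D) = (\<Prod>a\<in>?R. [:- a, 1:])"
    by (intro prod.cong) auto
  with D show ?thesis by simp
qed

theorem theorem8:
  fixes n :: nat and D :: "complex poly" and z :: "nat \<Rightarrow> complex"
    and \<gamma> r :: "nat \<Rightarrow> real \<Rightarrow> complex"
  assumes "n \<ge> 1"
    and "lead_coeff D = 1" and "degree D = 2 * n"
    and "inj_on z {1..2 * n}" and "{x. poly D x = 0} = z ` {1..2 * n}"
    and "\<And>j. j \<in> {2..2 * n} \<Longrightarrow>
           valid_path (\<gamma> j) \<and> pathstart (\<gamma> j) = z 1 \<and> pathfinish (\<gamma> j) = z j \<and>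
           (\<forall>t\<in>{0<..<1}. poly D (\<gamma> j t) \<noteq> 0)"
    and "\<And>j. j \<in> {2..2 * n} \<Longrightarrow> sqrt_along D (\<gamma> j) (r j)"
  shows "pellian D \<longleftrightarrow>
           (\<exists>U. is_U D U \<and>
             (\<forall>j\<in>{2..2 * n}. \<exists>m::int.
                has_integral_U_over_sqrt U (r j) (of_int m * (of_real pi * \<i>)) (\<gamma> j)))"
proof -
  define R where "R = {x. poly D x = 0}"
  have R: "R = z ` {1..2 * n}" using assms(5) by (simp add: R_def)
  have fin: "finite R" and card: "card R = 2 * n" using assms(4) by (simp_all add: R card_image)
  have z1: "z 1 \<in> R" using \<open>n \<ge> 1\<close> by (auto simp: R)
  have D: "D = (\<Prod>a\<in>R. [:- a, 1:])"
    using monic_simple_roots_factorization[OF assms(2)] assms(3) card by (simp add: R_def)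
  have polyD: "poly D x = (\<Prod>a\<in>R. x - a)" for x by (subst D) (simp add: poly_prod)
  show ?thesis
  proof
    assume "pellian D"
    then obtain p q0 where q0: "q0 \<noteq> 0" "p\<^sup>2 - q0\<^sup>2 * D = 1" by (auto simp: pellian_def)
    \<comment> \<open>The sum of leading coefficients can vanish for only one of the signs of q,
      since q is nonzero; this selects the growing p + q sqrt D.\<close>
    obtain q where q: "q \<noteq> 0" "p\<^sup>2 - q\<^sup>2 * D = 1" "lead_coeff p + lead_coeff q \<noteq> 0"
    proof (cases "lead_coeff p + lead_coeff q0 = 0")
      case True
      then have "lead_coeff p = - lead_coeff q0" by (simp add: add_eq_0_iff)
      then have "lead_coeff p + lead_coeff (- q0) \<noteq> 0" using q0(1) by (simp add: lead_coeff_minus)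
      then show ?thesis using that[of "- q0"] q0 by simp
    qed (use q0 in blast)
    obtain V where V: "pderiv p = q * V" "2 * (p * V) = 2 * (pderiv q * D) + q * pderiv D"
      using pell_derivative_quotient[OF q(2,1)] by blast
    have "R \<noteq> {}" using z1 by auto
    then have "is_U D (poly V)" by (rule is_U_if_pell[OF fin _ D card q(2,1) V q(3)])
    moreover have "\<exists>m::int. has_integral_U_over_sqrt (poly V) (r j) (of_int m * (of_real pi * \<i>)) (\<gamma> j)"
      if j: "j \<in> {2..2 * n}" for j
    proof (rule pell_integral[OF q(2) V])
      have "z 1 \<in> R" "z j \<in> R" using j by (auto simp: R)
      then show "poly D (pathstart (\<gamma> j)) = 0" "poly D (pathfinish (\<gamma> j)) = 0"
        using assms(6)[OF j] by (auto simp: R_def)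
    qed (use assms(6,7)[OF j] in auto)
    ultimately show "\<exists>U. is_U D U \<and> (\<forall>j\<in>{2..2 * n}. \<exists>m::int.
        has_integral_U_over_sqrt U (r j) (of_int m * (of_real pi * \<i>)) (\<gamma> j))" by blast
  next
    assume "\<exists>U. is_U D U \<and> (\<forall>j\<in>{2..2 * n}. \<exists>m::int.
        has_integral_U_over_sqrt U (r j) (of_int m * (of_real pi * \<i>)) (\<gamma> j))"
    then obtain U where U: "is_U D U"
      and int: "\<And>j. j \<in> {2..2 * n} \<Longrightarrow> \<exists>m::int. has_integral_U_over_sqrt U (r j) (of_int m * (of_real pi * \<i>)) (\<gamma> j)"
      by blast
    have holU: "U holomorphic_on UNIV"
      using U unfolding is_U_def is_U_D_def by (auto intro!: holomorphic_intros)
    obtain b where b: "\<And>a c. a \<in> R \<Longrightarrow> c \<in> R \<Longrightarrow> a \<noteq> c \<Longrightarrow> Im ((a - b) / (c - b)) \<noteq> 0"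
      using generic_base_point[OF fin] by blast
    interpret slit_plane R b
      by unfold_locales (use fin card \<open>n \<ge> 1\<close> b in auto)
    obtain \<Phi> K e where "slit_primitive R b U \<Phi> K e" and e0: "e (z 1) = 0"
      using slit_primitive_locale_exists[OF holU z1] by blast
    then interpret slit_primitive R b U \<Phi> K e by simp
    have "\<exists>m::int. of_int m * (of_real pi * \<i>) - e a \<in> even_periods" if a: "a \<in> R" "a \<noteq> z 1" for a
    proof -
      obtain i where i: "i \<in> {1..2 * n}" "a = z i" using a(1) by (auto simp: R)
      then have j: "i \<in> {2..2 * n}" using a(2) by (cases "i = 1") auto
      obtain m :: int where "has_integral_U_over_sqrt U (r i) (of_int m * (of_real pi * \<i>)) (\<gamma> i)"
        using int[OF j] by blast
      then have "of_int m * (of_real pi * \<i>) - e a \<in> even_periods"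
      proof (rule path_integral_value)
        show "pathfinish (\<gamma> i) = a" using assms(6)[OF j] i by simp
        show "continuous_on {0..1} (r i)" using assms(7)[OF j] by (simp add: sqrt_along_def)
        show "(r i t)\<^sup>2 = (\<Prod>c\<in>R. \<gamma> i t - c)" if "t \<in> {0..1}" for t
          using assms(7)[OF j] that by (simp add: sqrt_along_def polyD)
        show "\<gamma> i t \<notin> R" if "t \<in> {0<..<1}" for t using assms(6)[OF j] that by (simp add: R_def)
      qed (use assms(6)[OF j] z1 e0 a(1) in auto)
      then show ?thesis by blast
    qed
    then obtain N :: nat where "N > 0" "\<And>a. a \<in> R \<Longrightarrow> \<exists>m::int. of_nat N * e a = of_int m * (of_real pi * \<i>)"
      using periods_commensurable[OF z1 e0] by blast
    moreover have "even (card R)" by (simp add: card)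
    ultimately have "pellian (\<Prod>a\<in>R. [:- a, 1:])"
      by (intro pellian_if_is_U[OF U[unfolded D]])
    then show "pellian D" by (simp only: D)
  qed
qed

end
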